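(* Let $\mathbb{R}_+^2=\{z\in\mathbb{C}:\operatorname{Im} z>0\}$. For $p>1$, suppose that $\mu_1$ and $\mu_2$ are two weights on $\mathbb{R}_+^2$ such that $c\mu_1\ge\mu_2$ for some constant $c>0$. Then the inequality $$\int_{\mathbb{R}_+^2}\left|\int_{\mathbb{R}_+^2}-\frac{f(w)}{(z-\overline{w})^2}\,dA(w)\right|^p\mu_1(z)\,dA(z)\le C\int_{\mathbb{R}_+^2}|f(z)|^p\mu_2(z)\,dA(z)$$ holds, for some constant $C>0$ and all $f\in L^p(\mathbb{R}_+^2,\mu_2)$, if and only if $(\mu_1,\mu_2)\in A_p^+(\mathbb{R}_+^2)$.
   Context: A weight on $\mathbb{R}_+^2$ is a measurable function that is positive almost everywhere and locally integrable on $\mathbb{R}_+^2$. $dA$ is Lebesgue area measure, normalized so that the unit disk has area $1$, and $|W|$ is the measure of $W$. $L^p(\mathbb{R}_+^2,\mu_2)$ is the space of measurable $f$ with $\int_{\mathbb{R}_+^2}|f|^p\mu_2\,dA<\infty$; the validity of the inequality for $f$ includes that the inner integral converges absolutely for almost every $z$. Let $p'$ be the conjugate exponent of $p$. One says $(\mu_1,\mu_2)\in A_p^+(\mathbb{R}_+^2)$ if there is a constant $c>0$ such that $$\left(\frac{1}{|D\cap\mathbb{R}_+^2|}\int_{D\cap\mathbb{R}_+^2}\mu_1\,dA\right)\left(\frac{1}{|D\cap\mathbb{R}_+^2|}\int_{D\cap\mathbb{R}_+^2}\mu_2^{-p'/p}\,dA\right)^{p/p'}\le c$$ for all special disks $D$,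 i.e. all disks $D\subset\mathbb{C}$ centered at some $x\in\mathbb{R}$. *)

theory Defs
  imports "HOL-Analysis.Analysis"
begin

definition uhp :: "complex set" where
  "uhp = {z. 0 < Im z}"

definition area :: "complex measure" where
  "area = density lebesgue (\<lambda>_. ennreal (1 / pi))"

lemma emeasure_area_unit_disk: "emeasure area (ball 0 1) = 1"
proof -
  have "emeasure area (ball 0 1) = ennreal (1 / pi) * emeasure lebesgue (ball (0::complex) 1)"
    unfolding area_def by (rule emeasure_density_const) simp
  also have "emeasure lebesgue (ball (0::complex) 1) = ennreal pi"
    by (simp add: emeasure_ball unit_ball_vol_2)
  also have "ennreal (1 / pi) * ennreal pi = 1"
    by (simp flip: ennreal_mult)
  finally show ?thesis .
qed

definition is_weight :: "(complex \<Rightarrow> real) \<Rightarrow> bool" where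
  "is_weight \<mu> \<longleftrightarrow>
     set_borel_measurable area uhp \<mu> \<and>
     (AE z\<in>uhp in area. 0 < \<mu> z) \<and>
     (\<forall>K. compact K \<and> K \<subseteq> uhp \<longrightarrow> set_integrable area K \<mu>)"

definition weighted_Lp :: "real \<Rightarrow> (complex \<Rightarrow> real) \<Rightarrow> (complex \<Rightarrow> complex) set" where
  "weighted_Lp p \<mu> =
     {f. set_borel_measurable area uhp f \<and>
         (\<integral>\<^sup>+z\<in>uhp. ennreal (norm (f z) powr p * \<mu> z) \<partial>area) < \<infinity>}"

definition bergman_kernel_integrand :: "(complex \<Rightarrow> complex) \<Rightarrow> complex \<Rightarrow> complex \<Rightarrow> complex" where
  "bergman_kernel_integrand f z w = - (f w / (z - cnj w)\<^sup>2)"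

definition bergman_proj :: "(complex \<Rightarrow> complex) \<Rightarrow> complex \<Rightarrow> complex" where
  "bergman_proj f z = (LINT w:uhp|area. bergman_kernel_integrand f z w)"

definition area_mean :: "complex set \<Rightarrow> (complex \<Rightarrow> real) \<Rightarrow> ennreal" where
  "area_mean W \<mu> = (\<integral>\<^sup>+z\<in>W. ennreal (\<mu> z) \<partial>area) / emeasure area W"

text \<open>Real powers of extended nonnegative reals; only meant for exponents \<open>a > 0\<close>.\<close>

definition ennpowr :: "ennreal \<Rightarrow> real \<Rightarrow> ennreal" where
  "ennpowr x a = (if x = \<infinity> then \<infinity> else ennreal (enn2real x powr a))"

definition conj_exponent :: "real \<Rightarrow> real" where
  "conj_exponent p = p / (p - 1)"

text \<open>A weight need only be integrable on compact subsets of the open half-plane, so its mean over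
  a special disk may be infinite. The means therefore take values in \<^typ>\<open>ennreal\<close>. Since weights
  are positive and finite almost everywhere, neither mean below vanishes; an infinite mean thus
  violates the bound, and the convention \<open>0 * \<infinity> = 0\<close> plays no role.\<close>

definition Ap_plus :: "real \<Rightarrow> ((complex \<Rightarrow> real) \<times> (complex \<Rightarrow> real)) set" where
  "Ap_plus p = {(\<mu>\<^sub>1, \<mu>\<^sub>2). \<exists>c>0. \<forall>x r::real. 0 < r \<longrightarrow>
     (let W = ball (complex_of_real x) r \<inter> uhp; q = conj_exponent p
      in area_mean W \<mu>\<^sub>1 * ennpowr (area_mean W (\<lambda>z. \<mu>\<^sub>2 z powr (- q / p))) (p / q)
           \<le> ennreal c)}"

end

theory Submission
  imports Defs
begin

text \<open>
  Write \<open>\<sigma>\<close> for the dual weight \<open>\<mu>\<^sub>2 powr (-1 / (p - 1))\<close>, so that \<open>\<mu>\<^sub>2 powr (1/p) * \<sigma> powr ((p - 1)/p) = 1\<close>.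

  Sufficiency: for a Carleson box \<open>Q\<close> with top half \<open>T\<close>, Hoelder's inequality on \<open>T\<close> together with
  \<open>\<mu>\<^sub>2 \<le> c \<mu>\<^sub>1\<close> bounds \<open>\<mu>\<^sub>1(T) \<sigma>(T)^(p-1)\<close> from below by a multiple of \<open>|Q|^p\<close>, while the \<open>A_p\<close> condition bounds
  \<open>\<mu>\<^sub>1(Q) \<sigma>(Q)^(p-1)\<close> from above by such a multiple. Hence \<open>\<mu>\<^sub>1\<close> and \<open>\<sigma>\<close> each give \<open>T\<close> a fixed proportion of the mass
  of \<open>Q\<close>, their mass near the real axis decays geometrically, and some negative power of \<open>Im z\<close> is
  integrable over \<open>Q\<close> with the scale-invariant bound. The kernel is dominated by a sum over boxes of dyadic
  size with bounded overlap at each scale, and a Schur test with powers of \<open>Im z / L\<close>, where \<open>L\<close> is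
  the side of the box, concludes.

  Necessity: the kernel has no cancellation between two half-disks of radius \<open>r\<close> whose centres are \<open>6r\<close> apart.
  Testing on the indicator of a compact part of the neighbour \<open>D'\<close> of \<open>D\<close>, and using \<open>\<mu>\<^sub>2 \<le> c \<mu>\<^sub>1\<close>, gives
  \<open>\<mu>\<^sub>1(D) \<le> C \<mu>\<^sub>1(D')\<close>; testing on truncations of \<open>\<sigma>\<close> on \<open>D\<close> gives the \<open>A_p\<close> bound with \<open>\<mu>\<^sub>1(D')\<close> in
  place of \<open>\<mu>\<^sub>1(D)\<close>.
\<close>

text \<open>Young's inequality applied to \<open>f\<close> and \<open>g\<close> scaled by the bounds
  on their norms, then integrated. Numerical bounds on nonnegative integrals over an arbitrary
  measure let it serve both for area integrals and, with counting measure, for series over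
  boxes.\<close>

lemma nn_integral_Holder:
  fixes f g :: "'a \<Rightarrow> real" and p A B :: real
  assumes p: "1 < p"
    and [measurable]: "f \<in> borel_measurable M" "g \<in> borel_measurable M"
    and nonneg: "\<And>x. 0 \<le> f x" "\<And>x. 0 \<le> g x" "0 \<le> A" "0 \<le> B"
    and A: "(\<integral>\<^sup>+x. ennreal (f x powr p) \<partial>M) \<le> ennreal A"
    and B: "(\<integral>\<^sup>+x. ennreal (g x powr (p / (p - 1))) \<partial>M) \<le> ennreal B"
  shows "(\<integral>\<^sup>+x. ennreal (f x * g x) \<partial>M) \<le> ennreal (A powr (1 / p) * B powr ((p - 1) / p))"
proof (cases "A = 0 \<or> B = 0")
  case True
  \<comment> \<open>A vanishing bound rules out the scaling used in the main case, but then one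
    factor is zero almost everywhere.\<close>
  have "AE x in M. f x * g x = 0"
    using True
  proof
    assume "A = 0"
    then have "AE x in M. ennreal (f x powr p) = 0"
      using A by (subst nn_integral_0_iff_AE[symmetric]) auto
    then show ?thesis by eventually_elim (auto simp: ennreal_eq_0_iff)
  next
    assume "B = 0"
    then have "AE x in M. ennreal (g x powr (p / (p - 1))) = 0"
      using B by (subst nn_integral_0_iff_AE[symmetric]) auto
    then show ?thesis by eventually_elim (auto simp: ennreal_eq_0_iff)
  qed
  then have "(\<integral>\<^sup>+x. ennreal (f x * g x) \<partial>M) = (\<integral>\<^sup>+x. 0 \<partial>M)"
    by (intro nn_integral_cong_AE) (auto elim: eventually_mono)
  then show ?thesis by simp
next
  case False
  then have AB: "0 < A" "0 < B" using nonneg by auto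
  define q where "q = p / (p - 1)"
  have q: "1 < q" "1 / p + 1 / q = 1" "1 / q = (p - 1) / p"
    using p by (auto simp: q_def field_simps)
  define a where "a = A powr (1 / p)"
  define b where "b = B powr (1 / q)"
  have ab: "0 < a" "0 < b" "a powr p = A" "b powr q = B"
    using AB p q(1) by (auto simp: a_def b_def powr_powr)
  \<comment> \<open>Young's inequality for \<open>f x / a\<close> and \<open>g x / b\<close>,
    multiplied by \<open>a * b\<close>. As \<open>a powr p = A\<close> and
    \<open>b powr q = B\<close>, integration leaves
    \<open>a * b * (1 / p + 1 / q) = a * b\<close>.\<close>
  have young: "f x * g x \<le> a * b / (p * A) * f x powr p + a * b / (q * B) * g x powr q" for x
  proof -
    have "(f x / a) * (g x / b) \<le> (f x / a) powr p / p + (g x / b) powr q / q"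
      using p q ab nonneg by (intro Youngs_inequality) auto
    then have "a * b * ((f x / a) * (g x / b)) \<le> a * b * ((f x / a) powr p / p + (g x / b) powr q / q)"
      using ab by (intro mult_left_mono) auto
    then show ?thesis using ab nonneg by (simp add: powr_divide field_simps)
  qed
  have "(\<integral>\<^sup>+x. ennreal (f x * g x) \<partial>M)
      \<le> (\<integral>\<^sup>+x. ennreal (a * b / (p * A)) * ennreal (f x powr p)
            + ennreal (a * b / (q * B)) * ennreal (g x powr q) \<partial>M)"
    using young ab AB p q
    by (intro nn_integral_mono) (auto simp flip: ennreal_mult ennreal_plus intro!: ennreal_leI)
  also have "\<dots> = ennreal (a * b / (p * A)) * (\<integral>\<^sup>+x. ennreal (f x powr p) \<partial>M)
      + ennreal (a * b / (q * B)) * (\<integral>\<^sup>+x. ennreal (g x powr q) \<partial>M)"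
    by (simp add: nn_integral_add nn_integral_cmult)
  also have "\<dots> \<le> ennreal (a * b / (p * A)) * ennreal A + ennreal (a * b / (q * B)) * ennreal B"
    using A B by (intro add_mono mult_left_mono) (auto simp: q_def)
  also have "\<dots> = ennreal (a * b * (1 / p + 1 / q))"
    using ab AB p q(1)
    by (simp flip: ennreal_mult ennreal_plus add: field_simps)
  also have "\<dots> = ennreal (A powr (1 / p) * B powr ((p - 1) / p))"
    using q by (simp add: a_def b_def)
  finally show ?thesis .
qed

section \<open>Carleson boxes\<close>

lemma sets_area: "sets area = sets lebesgue"
  by (simp add: area_def)

lemma space_area [simp]: "space area = UNIV"
  by (simp add: area_def)

lemma borel_in_sets_area: "A \<in> sets borel \<Longrightarrow> A \<in> sets area"
  by (simp add: sets_area)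

lemma measurable_area_borel [measurable (raw)]: "f \<in> borel_measurable borel \<Longrightarrow> f \<in> borel_measurable area"
  by (simp add: area_def measurable_completion)

lemma Re_measurable_area [measurable]: "Re \<in> borel_measurable area"
  by (rule measurable_area_borel) simp

lemma Im_measurable_area [measurable]: "Im \<in> borel_measurable area"
  by (rule measurable_area_borel) simp

lemma emeasure_area: "A \<in> sets borel \<Longrightarrow> emeasure area A = ennreal (1 / pi) * emeasure lborel A"
  by (simp add: area_def emeasure_density_const)

lemma emeasure_area_ball: "0 \<le> r \<Longrightarrow> emeasure area (ball c r) = ennreal (r\<^sup>2)"
  by (simp add: emeasure_area emeasure_ball unit_ball_vol_2 flip: ennreal_mult)

lemma emeasure_area_rectangle:
  assumes "0 \<le> b" "0 \<le> d"
  shows "emeasure area (box (Complex a c) (Complex (a + b) (c + d))) = ennreal (b * d / pi)"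
proof -
  have "emeasure lborel (box (Complex a c) (Complex (a + b) (c + d))) = ennreal (b * d)"
    using assms by (subst emeasure_lborel_box) (auto simp: Basis_complex_def inner_complex_def)
  then show ?thesis
    using assms by (simp add: emeasure_area field_simps flip: ennreal_mult)
qed

lemma uhp_sets_area [measurable]: "uhp \<in> sets area"
proof -
  have "{z \<in> space area. 0 < Im z} \<in> sets area" by measurable
  then show ?thesis by (simp add: uhp_def)
qed

text \<open>The edges are chosen so that a box is the disjoint union of its top half
  \<open>box_top\<close> and of two boxes of half the side.\<close>

definition carleson_box :: "real \<Rightarrow> real \<Rightarrow> complex set" where
  "carleson_box a L = {z. a \<le> Re z \<and> Re z < a + L \<and> 0 < Im z \<and> Im z < L}"

definition box_top :: "real \<Rightarrow> real \<Rightarrow> complex set" where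
  "box_top a L = {z. a \<le> Re z \<and> Re z < a + L \<and> L / 2 \<le> Im z \<and> Im z < L}"

lemma carleson_box_sets [measurable]: "carleson_box a L \<in> sets area"
proof -
  have "{z \<in> space area. a \<le> Re z \<and> Re z < a + L \<and> 0 < Im z \<and> Im z < L} \<in> sets area"
    by measurable
  then show ?thesis by (simp add: carleson_box_def)
qed

lemma box_top_sets [measurable]: "box_top a L \<in> sets area"
proof -
  have "{z \<in> space area. a \<le> Re z \<and> Re z < a + L \<and> L / 2 \<le> Im z \<and> Im z < L} \<in> sets area"
    by measurable
  then show ?thesis by (simp add: box_top_def)
qed

lemma carleson_box_subset_uhp: "carleson_box a L \<subseteq> uhp"
  by (auto simp: carleson_box_def uhp_def)

lemma box_top_subset: "0 < L \<Longrightarrow> box_top a L \<subseteq> carleson_box a L"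
  by (auto simp: carleson_box_def box_top_def)

lemma emeasure_box_top_ge:
  assumes "0 < L"
  shows "ennreal (L\<^sup>2 / (2 * pi)) \<le> emeasure area (box_top a L)"
proof -
  have "ennreal (L\<^sup>2 / (2 * pi)) = emeasure area (box (Complex a (L/2)) (Complex (a + L) (L/2 + L/2)))"
    using assms by (subst emeasure_area_rectangle) (auto simp: power2_eq_square)
  also have "\<dots> \<le> emeasure area (box_top a L)"
    using assms by (intro emeasure_mono box_top_sets) (auto simp: box_top_def in_box_complex_iff)
  finally show ?thesis .
qed

text \<open>The centre is real, so this ball is a special disk; a condition on special disks thereby
  passes to boxes with a loss of constants only.\<close>

lemma carleson_box_subset_ball:
  assumes "0 < L"
  shows "carleson_box a L \<subseteq> ball (complex_of_real (a + L / 2)) (2 * L) \<inter> uhp"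
proof
  fix z assume z: "z \<in> carleson_box a L"
  have "norm (z - complex_of_real (a + L / 2)) \<le> \<bar>Re z - (a + L/2)\<bar> + \<bar>Im z\<bar>"
    using cmod_le[of "z - complex_of_real (a + L / 2)"] by simp
  also have "\<dots> < 2 * L" using z by (auto simp: carleson_box_def)
  finally show "z \<in> ball (complex_of_real (a + L / 2)) (2 * L) \<inter> uhp"
    using z carleson_box_subset_uhp by (auto simp: dist_norm norm_minus_commute)
qed

section \<open>Geometric decay of mass near the real axis\<close>

lemma ennreal_le_suminf: "f k \<le> (\<Sum>k. f k :: ennreal)"
  using sum_le_suminf[OF summableI, of "{k}" f] by simp

text \<open>The top half carries at least \<open>1 / c\<close> of the mass of a box, so the two
  boxes below it carry together at most \<open>1 - 1 / c\<close>. The strip of index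
  \<open>Suc k\<close> of the large box consists of the strips of index \<open>k\<close> of these
  two boxes, so induction multiplies the factors.\<close>

lemma strip_mass_decay:
  fixes N :: "complex measure"
  assumes N: "sets N = sets area"
    and fin: "\<And>a L. 0 < L \<Longrightarrow> emeasure N (carleson_box a L) < \<infinity>"
    and top: "\<And>a L. 0 < L \<Longrightarrow> emeasure N (carleson_box a L) \<le> ennreal c * emeasure N (box_top a L)"
    and c: "1 < c" and L: "0 < L"
  shows "emeasure N (carleson_box a L \<inter> {z. Im z < L / 2 ^ k})
    \<le> ennreal ((1 - 1 / c) ^ k) * emeasure N (carleson_box a L)"
  using L
proof (induction k arbitrary: a L)
  case 0
  then show ?case by (auto intro!: emeasure_mono simp: N)
next
  case (Suc k)
  define h where "h = L / 2"
  have h: "0 < h" "L = 2 * h" using Suc.prems by (auto simp: h_def)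
  have [measurable]: "carleson_box a L \<inter> {z. Im z < t} \<in> sets N" for a L t
  proof -
    have "{z \<in> space area. z \<in> carleson_box a L \<and> Im z < t} \<in> sets area" by measurable
    then show ?thesis by (simp add: N Int_def)
  qed
  have [measurable]: "carleson_box a L \<in> sets N" "box_top a L \<in> sets N" for a L
    by (simp_all add: N)
  have low: "emeasure N (carleson_box a h \<union> carleson_box (a + h) h) \<le> ennreal (1 - 1 / c) * emeasure N (carleson_box a L)"
  proof -
    let ?low = "carleson_box a h \<union> carleson_box (a + h) h"
    have dec: "emeasure N ?low + emeasure N (box_top a L) = emeasure N (carleson_box a L)"
    proof -
      have "?low \<union> box_top a L = carleson_box a L" "?low \<inter> box_top a L = {}"
        using h(1) by (auto simp: carleson_box_def box_top_def h(2))
      then show ?thesis by (subst plus_emeasure) auto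
    qed
    \<comment> \<open>Finiteness permits subtraction in the reals: \<open>X = Y + Z\<close> and
      \<open>X \<le> c * Z\<close> give \<open>Y \<le> (1 - 1 / c) * X\<close>.\<close>
    have "emeasure N (carleson_box a L) \<noteq> \<infinity>" using fin[of L a] Suc.prems by simp
    then obtain X where X: "0 \<le> X" "emeasure N (carleson_box a L) = ennreal X"
      by (cases "emeasure N (carleson_box a L)") auto
    have "emeasure N ?low \<noteq> \<infinity>" "emeasure N (box_top a L) \<noteq> \<infinity>"
      using dec X by (auto simp: add_top)
    then obtain Y Z where YZ: "0 \<le> Y" "emeasure N ?low = ennreal Y" "0 \<le> Z" "emeasure N (box_top a L) = ennreal Z"
      by (metis ennreal_cases infinity_ennreal_def)
    have "Y + Z = X" using dec X YZ by (simp flip: ennreal_plus)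
    moreover have "X \<le> c * Z" using top[of L a] X YZ c Suc.prems by (simp flip: ennreal_mult)
    ultimately have "X \<le> c * (X - Y)" by (metis add_diff_cancel_left')
    then have "Y \<le> (1 - 1 / c) * X" using c by (simp add: field_simps)
    then show ?thesis using X YZ c by (simp flip: ennreal_mult)
  qed
  have "carleson_box a L \<inter> {z. Im z < L / 2 ^ Suc k}
      = (carleson_box a h \<inter> {z. Im z < h / 2 ^ k}) \<union> (carleson_box (a + h) h \<inter> {z. Im z < h / 2 ^ k})"
  proof (intro set_eqI)
    fix z
    have "h / 2 ^ k \<le> h" using h(1) by (simp add: divide_le_eq_1 field_simps)
    moreover have "L / 2 ^ Suc k = h / 2 ^ k" by (simp add: h_def)
    ultimately show "z \<in> carleson_box a L \<inter> {z. Im z < L / 2 ^ Suc k} \<longleftrightarrow>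
      z \<in> (carleson_box a h \<inter> {z. Im z < h / 2 ^ k}) \<union> (carleson_box (a + h) h \<inter> {z. Im z < h / 2 ^ k})"
      using h by (auto simp: carleson_box_def)
  qed
  then have "emeasure N (carleson_box a L \<inter> {z. Im z < L / 2 ^ Suc k})
      \<le> emeasure N (carleson_box a h \<inter> {z. Im z < h / 2 ^ k})
        + emeasure N (carleson_box (a + h) h \<inter> {z. Im z < h / 2 ^ k})"
    by (simp add: emeasure_subadditive)
  also have "\<dots> \<le> ennreal ((1 - 1 / c) ^ k) * emeasure N (carleson_box a h)
      + ennreal ((1 - 1 / c) ^ k) * emeasure N (carleson_box (a + h) h)"
    by (intro add_mono Suc.IH h)
  also have "\<dots> = ennreal ((1 - 1 / c) ^ k) * (emeasure N (carleson_box a h) + emeasure N (carleson_box (a + h) h))"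
    by (simp add: distrib_left)
  also have "emeasure N (carleson_box a h) + emeasure N (carleson_box (a + h) h)
      = emeasure N (carleson_box a h \<union> carleson_box (a + h) h)"
    by (rule plus_emeasure) (simp_all, auto simp: carleson_box_def)
  also have "ennreal ((1 - 1 / c) ^ k) * \<dots> \<le> ennreal ((1 - 1 / c) ^ k) * (ennreal (1 - 1 / c) * emeasure N (carleson_box a L))"
    by (intro mult_left_mono low) simp
  finally show ?case
    using c by (simp add: ennreal_mult mult_ac)
qed

text \<open>The box is cut into dyadic layers by height. If \<open>t\<close> is small enough, the
  growth of \<open>(L / Im z) powr t\<close> from layer to layer is slower than the decay of mass,
  and a geometric series remains. Neither \<open>t\<close> nor \<open>C\<close> depends on the
  box.\<close>

lemma carleson_box_negative_moment:
  fixes N :: "complex measure"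
  assumes N: "sets N = sets area"
    and fin: "\<And>a L. 0 < L \<Longrightarrow> emeasure N (carleson_box a L) < \<infinity>"
    and top: "\<And>a L. 0 < L \<Longrightarrow> emeasure N (carleson_box a L) \<le> ennreal c * emeasure N (box_top a L)"
    and c: "1 < c"
  shows "\<exists>t>0. \<exists>C>0. \<forall>a L. 0 < L \<longrightarrow>
    (\<integral>\<^sup>+z\<in>carleson_box a L. ennreal ((L / Im z) powr t) \<partial>N) \<le> ennreal C * emeasure N (carleson_box a L)"
proof -
  define \<theta> where "\<theta> = 1 - 1 / c"
  \<comment> \<open>Decay by \<open>\<theta> ^ k = r ^ k * r ^ k\<close>: one factor pays for the
    moment, whose exponent is fixed by \<open>2 powr t = 1 / r\<close>, and the other makes the
    series converge.\<close>
  define r where "r = sqrt \<theta>"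
  have \<theta>: "0 < \<theta>" "\<theta> < 1" using c by (auto simp: \<theta>_def)
  then have r: "0 < r" "r < 1" "r * r = \<theta>" by (auto simp: r_def)
  define t where "t = log 2 (1 / r)"
  have t: "0 < t" "2 powr t = 1 / r" using r by (auto simp: t_def)
  define C where "C = (1 / r) * (1 / (1 - r))"
  have "C > 0" using r by (simp add: C_def)
  have "(\<integral>\<^sup>+z\<in>carleson_box a L. ennreal ((L / Im z) powr t) \<partial>N) \<le> ennreal C * emeasure N (carleson_box a L)"
    if L: "0 < L" for a L
  proof -
    define E where "E k = carleson_box a L \<inter> {z. Im z < L / 2 ^ k}" for k :: nat
    have E [measurable]: "E k \<in> sets N" for k
    proof -
      have "{z \<in> space area. z \<in> carleson_box a L \<and> Im z < L / 2 ^ k} \<in> sets area" by measurable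
      then show ?thesis by (simp add: N Int_def E_def)
    qed
    have pw: "ennreal ((L / Im z) powr t) * indicator (carleson_box a L) z
        \<le> (\<Sum>k. ennreal ((1 / r) ^ Suc k) * indicator (E k) z)" for z
    proof (cases "z \<in> carleson_box a L")
      case True
      then have z: "0 < Im z" "Im z < L" by (auto simp: carleson_box_def)
      \<comment> \<open>The least exponent with \<open>L / Im z \<le> 2 ^ n\<close> is positive
        because \<open>Im z < L\<close>; writing it as \<open>Suc k\<close> gives the layer of
        \<open>z\<close>.\<close>
      obtain n where "L / Im z < 2 ^ n" using real_arch_pow[of 2 "L / Im z"] by auto
      then have n: "L / Im z \<le> 2 ^ n" by simp
      moreover have "\<not> L / Im z \<le> 2 ^ 0" using z by (simp add: field_simps)
      ultimately obtain k where k: "\<not> L / Im z \<le> 2 ^ k" "L / Im z \<le> 2 ^ Suc k"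
        using ex_least_nat_less[of "\<lambda>n. L / Im z \<le> 2 ^ n" n] by auto
      have "z \<in> E k" using k z True by (auto simp: E_def field_simps)
      have "(L / Im z) powr t \<le> (2 ^ Suc k) powr t"
        using k z t L by (intro powr_mono2) auto
      also have "\<dots> = (2 powr t) ^ Suc k"
        by (simp add: powr_powr powr_realpow[symmetric] powr_power mult.commute del: power_Suc)
      also have "\<dots> = (1 / r) ^ Suc k" using t by simp
      finally have "ennreal ((L / Im z) powr t) * indicator (carleson_box a L) z
          \<le> ennreal ((1 / r) ^ Suc k) * indicator (E k) z"
        using True \<open>z \<in> E k\<close> by (simp add: ennreal_leI del: power_Suc)
      also have "\<dots> \<le> (\<Sum>k. ennreal ((1 / r) ^ Suc k) * indicator (E k) z)"
        by (rule ennreal_le_suminf)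
      finally show ?thesis .
    qed simp
    have "(\<integral>\<^sup>+z\<in>carleson_box a L. ennreal ((L / Im z) powr t) \<partial>N)
        \<le> (\<integral>\<^sup>+z. (\<Sum>k. ennreal ((1 / r) ^ Suc k) * indicator (E k) z) \<partial>N)"
      by (intro nn_integral_mono pw)
    also have "\<dots> = (\<Sum>k. ennreal ((1 / r) ^ Suc k) * emeasure N (E k))"
      by (subst nn_integral_suminf) (simp_all add: nn_integral_cmult)
    also have "\<dots> \<le> (\<Sum>k. ennreal ((1 / r) * r ^ k) * emeasure N (carleson_box a L))"
    proof (intro suminf_le summableI)
      fix k
      have "ennreal ((1 / r) ^ Suc k) * emeasure N (E k)
          \<le> ennreal ((1 / r) ^ Suc k) * (ennreal (\<theta> ^ k) * emeasure N (carleson_box a L))"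
        unfolding E_def \<theta>_def by (intro mult_left_mono strip_mass_decay assms L) auto
      also have "\<dots> = ennreal ((1 / r) * r ^ k) * emeasure N (carleson_box a L)"
        using r by (simp add: mult.assoc[symmetric] power_mult_distrib power_divide flip: ennreal_mult \<open>r * r = \<theta>\<close>)
      finally show "ennreal ((1 / r) ^ Suc k) * emeasure N (E k)
          \<le> ennreal ((1 / r) * r ^ k) * emeasure N (carleson_box a L)" .
    qed
    also have "\<dots> = (\<Sum>k. ennreal ((1 / r) * r ^ k)) * emeasure N (carleson_box a L)"
      by (rule ennreal_suminf_multc)
    also have "(\<Sum>k. ennreal ((1 / r) * r ^ k)) = ennreal C"
      unfolding C_def using r by (intro suminf_ennreal_eq sums_mult geometric_sums) auto
    finally show ?thesis .
  qed
  then show ?thesis using t(1) \<open>C > 0\<close> by blast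
qed

section \<open>Covering pairs of points by boxes of dyadic size\<close>

lemma suminf_int_pairs:
  fixes F :: "int \<times> int \<Rightarrow> ennreal" and e :: "nat \<Rightarrow> int \<times> int"
  assumes e: "bij e"
  shows "(\<Sum>n. F (e n)) = (\<integral>\<^sup>+m. \<integral>\<^sup>+j. F (m, j) \<partial>count_space UNIV \<partial>count_space UNIV)"
proof -
  have "(\<Sum>n. F (e n)) = (\<integral>\<^sup>+n. F (e n) \<partial>count_space UNIV)"
    by (rule nn_integral_count_space_nat[symmetric])
  also have "\<dots> = (\<integral>\<^sup>+x. F x \<partial>count_space UNIV)"
    by (rule nn_integral_bij_count_space) (use e in auto)
  also have "\<dots> = (\<integral>\<^sup>+m. \<integral>\<^sup>+j. F (m, j) \<partial>count_space UNIV \<partial>count_space UNIV)"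
    by (rule nn_integral_fst_count_space[symmetric])
  finally show ?thesis .
qed

text \<open>For \<open>(m, j)\<close> and \<open>l = 2 powr m\<close>, the base is the interval from
  \<open>j * l\<close> to \<open>(j + 1) * l\<close> widened by \<open>2 * l\<close> on both sides,
  so a point above the interval shares the box with its neighbours at comparable distance.\<close>

definition scaled_box :: "int \<times> int \<Rightarrow> complex set" where
  "scaled_box mj = carleson_box ((of_int (snd mj) - 2) * 2 powr of_int (fst mj)) (5 * 2 powr of_int (fst mj))"

text \<open>The distance from \<open>z\<close> to \<open>cnj w\<close> dominates the horizontal
  separation and the sum of the two heights. A box at the dyadic scale of this distance therefore
  has room for both points, and the kernel is at most
  \<open>1 / l\<^sup>2 = 25 / (5 * l)\<^sup>2\<close>.\<close>

lemma scaled_box_cover: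
  assumes "z \<in> uhp" "w \<in> uhp"
  shows "\<exists>mj. z \<in> scaled_box mj \<and> w \<in> scaled_box mj \<and>
    1 / (norm (z - cnj w))\<^sup>2 \<le> 25 / (5 * 2 powr of_int (fst mj))\<^sup>2"
proof -
  define R where "R = norm (z - cnj w)"
  have "\<bar>Im (z - cnj w)\<bar> \<le> R" "\<bar>Re (z - cnj w)\<bar> \<le> R"
    unfolding R_def by (rule abs_Im_le_cmod abs_Re_le_cmod)+
  then have R: "Im z + Im w \<le> R" "\<bar>Re z - Re w\<bar> \<le> R" by auto
  have im: "0 < Im z" "0 < Im w" using assms by (auto simp: uhp_def)
  then have "0 < R" using R by linarith
  define m where "m = \<lfloor>log 2 R\<rfloor>"
  define l where "l = (2::real) powr of_int m"
  have l: "0 < l" "l \<le> R" "R < 2 * l"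
  proof -
    show "0 < l" by (simp add: l_def)
    have "l \<le> 2 powr (log 2 R)" unfolding l_def m_def by (intro powr_mono) auto
    then show "l \<le> R" using \<open>0 < R\<close> by simp
    have "2 powr (log 2 R) < 2 powr (of_int m + 1)" unfolding m_def by (intro powr_less_mono) linarith+
    then show "R < 2 * l" using \<open>0 < R\<close> by (simp add: l_def powr_add)
  qed
  \<comment> \<open>With this \<open>j\<close>, \<open>Re z\<close> lies in the unwidened interval,
    and \<open>Re w\<close> is less than \<open>2 * l\<close> away from \<open>Re z\<close>, hence
    still in the widened one.\<close>
  define j where "j = \<lfloor>Re z / l\<rfloor>"
  have "of_int j \<le> Re z / l" "Re z / l < of_int j + 1" unfolding j_def by linarith+
  then have j: "of_int j * l \<le> Re z" "Re z < of_int j * l + l"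
    using l by (auto simp: field_simps)
  have "z \<in> scaled_box (m, j)" "w \<in> scaled_box (m, j)"
    using j R l im by (auto simp: scaled_box_def carleson_box_def left_diff_distrib simp flip: l_def)
  moreover have "1 / R\<^sup>2 \<le> 1 / l\<^sup>2" using l by (intro divide_left_mono power_mono) auto
  then have "1 / R\<^sup>2 \<le> 25 / (5 * l)\<^sup>2" by (simp add: power_mult_distrib)
  ultimately show ?thesis unfolding R_def l_def by (intro exI[of _ "(m, j)"]) simp
qed

text \<open>A point lies in boxes of all large scales, so only a weighted count can be finite. At
  each scale at most five boxes contain \<open>z\<close>, scales with
  \<open>5 * 2 powr m \<le> Im z\<close> contribute nothing, and the weights decay geometrically as
  the scale grows.\<close>

lemma scaled_box_overlap:
  assumes \<alpha>: "0 < \<alpha>" and e: "bij e" and z: "z \<in> uhp"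
  shows "(\<Sum>n. ennreal ((Im z / (5 * 2 powr of_int (fst (e n)))) powr \<alpha>) * indicator (scaled_box (e n)) z)
    \<le> ennreal (5 / (1 - 2 powr (- \<alpha>)))"
proof -
  define y where "y = Im z"
  have y: "0 < y" using z by (simp add: y_def uhp_def)
  define g where "g m = (y / (5 * 2 powr of_int m)) powr \<alpha>" for m :: int
  \<comment> \<open>The smallest integer \<open>m\<close> with \<open>Im z < 5 * 2 powr m\<close>,
    that is, the first scale whose boxes reach the height of \<open>z\<close>.\<close>
  define m0 where "m0 = \<lfloor>log 2 (y / 5)\<rfloor> + 1"
  have inner: "(\<integral>\<^sup>+j. ennreal (g m) * indicator (scaled_box (m, j)) z \<partial>count_space UNIV)
    \<le> ennreal (5 * 2 powr (\<alpha> * of_int (m0 - m))) * indicator {m0..} m" for m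
  proof -
    define l where "l = (2::real) powr of_int m"
    have l: "0 < l" by (simp add: l_def)
    let ?J = "{\<lfloor>Re z / l\<rfloor> - 2 .. \<lfloor>Re z / l\<rfloor> + 2}"
    have sub: "j \<in> ?J \<and> m0 \<le> m" if "z \<in> scaled_box (m, j)" for j
    proof
      have b: "(of_int j - 2) * l \<le> Re z" "Re z < (of_int j - 2) * l + 5 * l" "y < 5 * l"
        using that by (auto simp: scaled_box_def carleson_box_def l_def y_def)
      have "of_int j - 2 \<le> Re z / l" "Re z / l < of_int j + 3"
        using b l by (auto simp: field_simps)
      then show "j \<in> ?J" by (simp, linarith)
      have "log 2 (y / 5) < log 2 l" using b y by (intro log_less) auto
      then have "log 2 (y / 5) < of_int m" by (simp add: l_def)
      then show "m0 \<le> m" unfolding m0_def by linarith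
    qed
    have g_le: "g m \<le> 2 powr (\<alpha> * of_int (m0 - m))" if "m0 \<le> m"
    proof -
      have "2 powr (log 2 (y / 5)) \<le> 2 powr of_int m0" unfolding m0_def by (intro powr_mono) linarith+
      then have "y / 5 \<le> 2 powr of_int m0" using y by simp
      then have "y / (5 * 2 powr of_int m) \<le> 2 powr of_int m0 / 2 powr of_int m"
        by (simp add: field_simps)
      also have "\<dots> = 2 powr of_int (m0 - m)" by (simp add: powr_diff)
      finally have "g m \<le> (2 powr of_int (m0 - m)) powr \<alpha>"
        unfolding g_def using y \<alpha> by (intro powr_mono2) auto
      then show ?thesis by (simp add: powr_powr mult.commute)
    qed
    have "(\<integral>\<^sup>+j. ennreal (g m) * indicator (scaled_box (m, j)) z \<partial>count_space UNIV)
      \<le> (\<integral>\<^sup>+j. ennreal (2 powr (\<alpha> * of_int (m0 - m))) * indicator {m0..} m * indicator ?J j \<partial>count_space UNIV)"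
      using sub g_le by (intro nn_integral_mono) (auto simp: indicator_def intro!: ennreal_leI)
    also have "\<dots> = ennreal (2 powr (\<alpha> * of_int (m0 - m))) * indicator {m0..} m * of_nat (card ?J)"
      by (subst nn_integral_cmult_indicator) auto
    also have "card ?J = 5" by simp
    also have "ennreal (2 powr (\<alpha> * of_int (m0 - m))) * indicator {m0..} m * of_nat 5
      = ennreal (5 * 2 powr (\<alpha> * of_int (m0 - m))) * indicator {m0..} m"
      by (simp add: ennreal_mult mult_ac)
    finally show ?thesis .
  qed
  have "(\<Sum>n. ennreal ((Im z / (5 * 2 powr of_int (fst (e n)))) powr \<alpha>) * indicator (scaled_box (e n)) z)
    = (\<integral>\<^sup>+m. \<integral>\<^sup>+j. ennreal (g m) * indicator (scaled_box (m, j)) z \<partial>count_space UNIV \<partial>count_space UNIV)"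
    using suminf_int_pairs[OF e, of "\<lambda>mj. ennreal (g (fst mj)) * indicator (scaled_box mj) z"]
    by (simp add: g_def y_def)
  also have "\<dots> \<le> (\<integral>\<^sup>+m. ennreal (5 * 2 powr (\<alpha> * of_int (m0 - m))) * indicator {m0..} m \<partial>count_space UNIV)"
    by (intro nn_integral_mono inner)
  also have "\<dots> = (\<integral>\<^sup>+m. ennreal (5 * 2 powr (\<alpha> * of_int (m0 - m))) \<partial>count_space {m0..})"
    by (simp add: nn_integral_count_space_indicator)
  also have "\<dots> = (\<integral>\<^sup>+k. ennreal (5 * 2 powr (\<alpha> * of_int (m0 - (m0 + int k)))) \<partial>count_space UNIV)"
  proof (rule nn_integral_bij_count_space[symmetric])
    show "bij_betw (\<lambda>k. m0 + int k) UNIV {m0..}"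
      by (rule bij_betwI[of _ _ _ "\<lambda>m. nat (m - m0)"]) auto
  qed
  also have "\<dots> = (\<Sum>k. ennreal (5 * (2 powr (- \<alpha>)) ^ k))"
    by (simp add: nn_integral_count_space_nat powr_power mult.commute)
  also have "\<dots> = ennreal (5 * (1 / (1 - 2 powr (- \<alpha>))))"
  proof (intro suminf_ennreal_eq sums_mult geometric_sums)
    have "(2::real) powr (- \<alpha>) < 2 powr 0" using \<alpha> by (intro powr_less_mono) auto
    then show "norm ((2::real) powr (- \<alpha>)) < 1" by simp
  qed simp
  finally show ?thesis by simp
qed

text \<open>The boxes are enumerated by natural numbers so that sums over them are series that can
  be exchanged with nonnegative integrals.\<close>

lemma carleson_box_covering:
  "\<exists>a L :: nat \<Rightarrow> real. (\<forall>n. 0 < L n) \<and>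
    (\<forall>z\<in>uhp. \<forall>w\<in>uhp. \<exists>n. z \<in> carleson_box (a n) (L n) \<and>
      w \<in> carleson_box (a n) (L n) \<and> 1 / (norm (z - cnj w))\<^sup>2 \<le> 25 / (L n)\<^sup>2) \<and>
    (\<forall>\<alpha>>0. \<forall>z\<in>uhp. (\<Sum>n. ennreal ((Im z / L n) powr \<alpha>) * indicator (carleson_box (a n) (L n)) z)
        \<le> ennreal (5 / (1 - 2 powr (- \<alpha>))))"
proof -
  have "infinite (UNIV :: (int \<times> int) set)"
    by (simp add: finite_prod infinite_UNIV_int)
  then obtain e :: "nat \<Rightarrow> int \<times> int" where e: "bij e"
    using bij_betw_from_nat_into[of "UNIV :: (int \<times> int) set"] by auto
  show ?thesis
  proof (rule exI[of _ "\<lambda>n. (of_int (snd (e n)) - 2) * 2 powr of_int (fst (e n))"],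
      rule exI[of _ "\<lambda>n. 5 * 2 powr of_int (fst (e n))"], intro conjI allI ballI impI, goal_cases)
    case (2 z w)
    obtain mj where "z \<in> scaled_box mj" "w \<in> scaled_box mj"
      "1 / (norm (z - cnj w))\<^sup>2 \<le> 25 / (5 * 2 powr of_int (fst mj))\<^sup>2"
      using scaled_box_cover[OF 2] by blast
    moreover obtain n where "mj = e n" using e by (metis bij_pointE)
    ultimately show ?case by (auto simp: scaled_box_def)
  next
    case (3 \<alpha> z)
    show ?case using scaled_box_overlap[OF 3(1) e 3(2)] by (simp add: scaled_box_def)
  qed simp
qed

section \<open>The \<open>A_p\<close> condition on Carleson boxes\<close>

text \<open>Here \<open>w\<close> and \<open>u\<close> stand for representatives of
  \<open>\<mu>\<^sub>1\<close> and \<open>\<mu>\<^sub>2\<close> that are measurable and positive on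
  the whole plane, so pointwise identities between their powers hold without exceptional
  sets.\<close>

locale half_plane_weights =
  fixes p c :: real and w u :: "complex \<Rightarrow> real"
  assumes p: "1 < p" and c: "0 < c"
    and meas [measurable]: "w \<in> borel_measurable area" "u \<in> borel_measurable area"
    and pos: "\<And>z. 0 < w z" "\<And>z. 0 < u z"
    and dom: "AE z\<in>uhp in area. u z \<le> c * w z"
begin

definition dual :: "complex \<Rightarrow> real" where
  "dual z = u z powr (- 1 / (p - 1))"

definition W :: "complex measure" where "W = density area (\<lambda>z. ennreal (w z))"

definition S :: "complex measure" where "S = density area (\<lambda>z. ennreal (dual z))"

lemma dual_measurable [measurable]: "dual \<in> borel_measurable area"
  unfolding dual_def by measurable

lemma dual_pos: "0 < dual z"
  using pos[of z] by (simp add: dual_def)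

lemma sets_W [simp, measurable_cong]: "sets W = sets area" by (simp add: W_def)

lemma sets_S [simp, measurable_cong]: "sets S = sets area" by (simp add: S_def)

lemma emeasure_W: "A \<in> sets area \<Longrightarrow> emeasure W A = (\<integral>\<^sup>+z\<in>A. ennreal (w z) \<partial>area)"
  unfolding W_def by (rule emeasure_density) auto

lemma emeasure_S: "A \<in> sets area \<Longrightarrow> emeasure S A = (\<integral>\<^sup>+z\<in>A. ennreal (dual z) \<partial>area)"
  unfolding S_def by (rule emeasure_density) auto

lemma nn_integral_W:
  "h \<in> borel_measurable area \<Longrightarrow> A \<in> sets area \<Longrightarrow> (\<integral>\<^sup>+z\<in>A. h z \<partial>W) = (\<integral>\<^sup>+z\<in>A. ennreal (w z) * h z \<partial>area)"
  unfolding W_def by (subst nn_integral_density) (auto simp: mult_ac)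

lemma nn_integral_S:
  "h \<in> borel_measurable area \<Longrightarrow> A \<in> sets area \<Longrightarrow> (\<integral>\<^sup>+z\<in>A. h z \<partial>S) = (\<integral>\<^sup>+z\<in>A. ennreal (dual z) * h z \<partial>area)"
  unfolding S_def by (subst nn_integral_density) (auto simp: mult_ac)

text \<open>The domination of \<open>u\<close> by \<open>c * w\<close> enters the argument through
  this estimate; both directions of the equivalence use it on the top half of a box.\<close>

lemma u_le_W:
  assumes [measurable]: "A \<in> sets area" and "A \<subseteq> uhp"
  shows "(\<integral>\<^sup>+z\<in>A. ennreal (u z) \<partial>area) \<le> ennreal c * emeasure W A"
proof -
  have "(\<integral>\<^sup>+z\<in>A. ennreal (u z) \<partial>area) \<le> (\<integral>\<^sup>+z. ennreal c * (ennreal (w z) * indicator A z) \<partial>area)"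
    using dom assms(2) c pos(1)
    by (intro nn_integral_mono_AE)
       (auto elim!: eventually_mono simp: indicator_def less_imp_le simp flip: ennreal_mult intro!: ennreal_leI)
  then show ?thesis by (simp add: nn_integral_cmult emeasure_W)
qed

lemma u_dual: "u z powr (1 / p) * dual z powr ((p - 1) / p) = 1"
proof -
  have "dual z powr ((p - 1) / p) = u z powr (- (1 / p))"
    using p by (simp add: dual_def powr_powr)
  then show ?thesis using pos(2)[of z] by (simp flip: powr_add)
qed

end

text \<open>The \<open>A_p\<close> bound on boxes with denominators cleared: the area is comparable
  to \<open>L\<^sup>2\<close>, and its powers \<open>1\<close> and \<open>p - 1\<close> combine to
  \<open>p\<close>. Finiteness is demanded separately because \<open>measure\<close> maps infinite
  mass to \<open>0\<close>.\<close>

locale half_plane_Ap = half_plane_weights +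
  fixes K :: real
  assumes K: "0 < K"
    and W_box: "\<And>a L. 0 < L \<Longrightarrow> emeasure W (carleson_box a L) < \<infinity>"
    and S_box: "\<And>a L. 0 < L \<Longrightarrow> emeasure S (carleson_box a L) < \<infinity>"
    and Ap_box: "\<And>a L. 0 < L \<Longrightarrow>
      measure W (carleson_box a L) * measure S (carleson_box a L) powr (p - 1) \<le> K * (L\<^sup>2) powr p"
begin

lemma emeasure_W_box: "0 < L \<Longrightarrow> emeasure W (carleson_box a L) = ennreal (measure W (carleson_box a L))"
  using W_box[of L a] by (simp add: emeasure_eq_ennreal_measure)

lemma emeasure_S_box: "0 < L \<Longrightarrow> emeasure S (carleson_box a L) = ennreal (measure S (carleson_box a L))"
  using S_box[of L a] by (simp add: emeasure_eq_ennreal_measure)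

lemma W_top: "0 < L \<Longrightarrow> emeasure W (box_top a L) \<le> emeasure W (carleson_box a L)"
  by (intro emeasure_mono box_top_subset) auto

lemma S_top: "0 < L \<Longrightarrow> emeasure S (box_top a L) \<le> emeasure S (carleson_box a L)"
  by (intro emeasure_mono box_top_subset) auto

lemma emeasure_W_top: "0 < L \<Longrightarrow> emeasure W (box_top a L) = ennreal (measure W (box_top a L))"
  using le_less_trans[OF W_top W_box, of L a] by (simp add: emeasure_eq_ennreal_measure)

lemma emeasure_S_top: "0 < L \<Longrightarrow> emeasure S (box_top a L) = ennreal (measure S (box_top a L))"
  using le_less_trans[OF S_top S_box, of L a] by (simp add: emeasure_eq_ennreal_measure)

text \<open>Hoelder's inequality for the factorization of \<open>1\<close> in \<open>u_dual\<close>,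
  integrated over the top half, whose area is at least \<open>L\<^sup>2 / (2 * pi)\<close>. This is
  the converse of the \<open>A_p\<close> bound.\<close>

lemma top_lower_bound:
  assumes L: "0 < L"
  shows "(L\<^sup>2 / (2 * pi)) powr p \<le> c * measure W (box_top a L) * measure S (box_top a L) powr (p - 1)"
proof -
  let ?T = "box_top a L"
  define X where "X = measure W ?T"
  define Y where "Y = measure S ?T"
  have XY: "0 \<le> X" "0 \<le> Y" by (auto simp: X_def Y_def)
  have TU: "?T \<subseteq> uhp" using box_top_subset[OF L] carleson_box_subset_uhp by blast
  have "ennreal (L\<^sup>2 / (2 * pi)) \<le> emeasure area ?T" by (rule emeasure_box_top_ge[OF L])
  also have "\<dots> = (\<integral>\<^sup>+z. ennreal ((u z powr (1 / p) * indicator ?T z) * (dual z powr ((p - 1) / p) * indicator ?T z)) \<partial>area)"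
  proof -
    have "indicator ?T z = ennreal ((u z powr (1 / p) * indicator ?T z) * (dual z powr ((p - 1) / p) * indicator ?T z))" for z
      using u_dual[of z] by (cases "z \<in> ?T") auto
    then show ?thesis by (simp only: nn_integral_indicator[symmetric, OF box_top_sets])
  qed
  also have "\<dots> \<le> ennreal ((c * X) powr (1 / p) * Y powr ((p - 1) / p))"
  proof (rule nn_integral_Holder[OF p])
    have "(\<integral>\<^sup>+z. ennreal ((u z powr (1 / p) * indicator ?T z) powr p) \<partial>area) = (\<integral>\<^sup>+z\<in>?T. ennreal (u z) \<partial>area)"
      using p pos(2) by (intro nn_integral_cong) (auto simp: indicator_def powr_powr less_imp_le)
    also have "\<dots> \<le> ennreal c * emeasure W ?T" by (intro u_le_W TU) simp
    also have "\<dots> = ennreal (c * X)" using L c by (simp add: X_def emeasure_W_top ennreal_mult)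
    finally show "(\<integral>\<^sup>+z. ennreal ((u z powr (1 / p) * indicator ?T z) powr p) \<partial>area) \<le> ennreal (c * X)" .
    have "(\<integral>\<^sup>+z. ennreal ((dual z powr ((p - 1) / p) * indicator ?T z) powr (p / (p - 1))) \<partial>area)
        = (\<integral>\<^sup>+z\<in>?T. ennreal (dual z) \<partial>area)"
      using p dual_pos by (intro nn_integral_cong) (auto simp: indicator_def powr_powr less_imp_le)
    also have "\<dots> = ennreal Y" using L by (simp add: Y_def emeasure_S_top flip: emeasure_S)
    finally show "(\<integral>\<^sup>+z. ennreal ((dual z powr ((p - 1) / p) * indicator ?T z) powr (p / (p - 1))) \<partial>area) \<le> ennreal Y"
      by simp
  qed (use XY c in auto)
  finally have "L\<^sup>2 / (2 * pi) \<le> (c * X) powr (1 / p) * Y powr ((p - 1) / p)"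
    by (simp add: ennreal_le_iff)
  then have "(L\<^sup>2 / (2 * pi)) powr p \<le> ((c * X) powr (1 / p) * Y powr ((p - 1) / p)) powr p"
    using p by (intro powr_mono2) auto
  also have "\<dots> = c * X * Y powr (p - 1)"
    using p XY c by (simp add: powr_mult powr_powr)
  finally show ?thesis by (simp add: X_def Y_def)
qed

text \<open>The \<open>A_p\<close> bound on the box and the lower bound on its top half control
  \<open>X * Y powr (p - 1)\<close> by the same product for the top. Replacing \<open>Y\<close> by
  the smaller \<open>Y'\<close> and cancelling bounds \<open>X\<close>; replacing \<open>X\<close>
  by the smaller \<open>X'\<close> and cancelling bounds \<open>Y\<close>.\<close>

lemma box_doubling:
  obtains d where "1 < d"
    "\<And>a L. 0 < L \<Longrightarrow> emeasure W (carleson_box a L) \<le> ennreal d * emeasure W (box_top a L)"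
    "\<And>a L. 0 < L \<Longrightarrow> emeasure S (carleson_box a L) \<le> ennreal d * emeasure S (box_top a L)"
proof -
  define k where "k = K * c * (2 * pi) powr p"
  have k: "0 < k" using K c by (simp add: k_def)
  \<comment> \<open>One constant for both measures; the \<open>2\<close> secures
    \<open>1 < d\<close>, which the decay estimate requires.\<close>
  define d where "d = max 2 (max k (k powr (1 / (p - 1))))"
  have d: "1 < d" "k \<le> d" "k powr (1 / (p - 1)) \<le> d" by (auto simp: d_def)
  have main: "measure W (carleson_box a L) \<le> d * measure W (box_top a L) \<and>
    measure S (carleson_box a L) \<le> d * measure S (box_top a L)" if L: "0 < L" for a L
  proof -
    define X Y X' Y' where "X = measure W (carleson_box a L)" and "Y = measure S (carleson_box a L)"
      and "X' = measure W (box_top a L)" and "Y' = measure S (box_top a L)"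
    \<comment> \<open>Strict positivity of the masses of the top half justifies the cancellations
      below.\<close>
    have "0 < (L\<^sup>2 / (2 * pi)) powr p" using L by simp
    also note lb = top_lower_bound[OF L, of a, folded X'_def Y'_def]
    finally have "0 < c * X' * Y' powr (p - 1)" .
    moreover have "0 \<le> X'" "0 \<le> Y'" by (auto simp: X'_def Y'_def)
    ultimately have pos': "0 < X'" "0 < Y'"
      using c p by (auto simp: zero_less_mult_iff less_le)
    have mono: "X' \<le> X" "Y' \<le> Y"
      using W_top[OF L, of a] S_top[OF L, of a] L
      by (simp_all add: X_def X'_def Y_def Y'_def emeasure_W_box emeasure_W_top emeasure_S_box emeasure_S_top)
    have "X * Y powr (p - 1) \<le> K * (L\<^sup>2) powr p"
      using Ap_box[OF L, of a] by (simp add: X_def Y_def)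
    also have "\<dots> = K * (2 * pi) powr p * (L\<^sup>2 / (2 * pi)) powr p"
      by (simp add: powr_divide)
    also have "\<dots> \<le> K * (2 * pi) powr p * (c * X' * Y' powr (p - 1))"
      using K by (intro mult_left_mono lb) auto
    finally have key: "X * Y powr (p - 1) \<le> k * X' * Y' powr (p - 1)" by (simp add: k_def mult_ac)
    have "X * Y' powr (p - 1) \<le> X * Y powr (p - 1)"
      using mono pos' p by (intro mult_left_mono powr_mono2) auto
    with key have "X * Y' powr (p - 1) \<le> (k * X') * Y' powr (p - 1)" by simp
    then have "X \<le> k * X'" using pos' by (simp only: mult_le_cancel_right) auto
    also have "\<dots> \<le> d * X'" using d pos' by (intro mult_right_mono) auto
    finally have 1: "X \<le> d * X'" .
    have "X' * Y powr (p - 1) \<le> X * Y powr (p - 1)"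
      using mono by (intro mult_right_mono) auto
    with key have "X' * Y powr (p - 1) \<le> X' * (k * Y' powr (p - 1))" by (simp add: mult_ac)
    then have "Y powr (p - 1) \<le> k * Y' powr (p - 1)" using pos' by (simp only: mult_le_cancel_left_pos)
    then have "(Y powr (p - 1)) powr (1 / (p - 1)) \<le> (k * Y' powr (p - 1)) powr (1 / (p - 1))"
      using p by (intro powr_mono2) auto
    then have "Y \<le> k powr (1 / (p - 1)) * Y'"
      using p pos' mono k by (simp add: powr_mult powr_powr)
    also have "\<dots> \<le> d * Y'" using d pos' by (intro mult_right_mono) auto
    finally have "Y \<le> d * Y'" .
    with 1 show ?thesis by (simp add: X_def X'_def Y_def Y'_def)
  qed
  show ?thesis
    by (rule that[of d]) (use main d in \<open>auto simp: emeasure_W_box emeasure_W_top emeasure_S_box emeasure_S_top simp flip: ennreal_mult intro!: ennreal_leI\<close>)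
qed

lemma box_moments:
  "\<exists>t s C. 0 < t \<and> 0 < s \<and> 0 < C \<and>
    (\<forall>a L. 0 < L \<longrightarrow> (\<integral>\<^sup>+z\<in>carleson_box a L. ennreal ((L / Im z) powr t) \<partial>W) \<le> ennreal C * emeasure W (carleson_box a L)) \<and>
    (\<forall>a L. 0 < L \<longrightarrow> (\<integral>\<^sup>+z\<in>carleson_box a L. ennreal ((L / Im z) powr s) \<partial>S) \<le> ennreal C * emeasure S (carleson_box a L))"
proof -
  obtain d where d: "1 < d"
    "\<And>a L. 0 < L \<Longrightarrow> emeasure W (carleson_box a L) \<le> ennreal d * emeasure W (box_top a L)"
    "\<And>a L. 0 < L \<Longrightarrow> emeasure S (carleson_box a L) \<le> ennreal d * emeasure S (box_top a L)"
    using box_doubling by blast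
  obtain t C1 where t: "0 < t" "0 < C1" and C1: "\<And>a L. 0 < L \<Longrightarrow>
     (\<integral>\<^sup>+z\<in>carleson_box a L. ennreal ((L / Im z) powr t) \<partial>W) \<le> ennreal C1 * emeasure W (carleson_box a L)"
    using carleson_box_negative_moment[of W d] W_box d by auto
  obtain s C2 where s: "0 < s" "0 < C2" and C2: "\<And>a L. 0 < L \<Longrightarrow>
     (\<integral>\<^sup>+z\<in>carleson_box a L. ennreal ((L / Im z) powr s) \<partial>S) \<le> ennreal C2 * emeasure S (carleson_box a L)"
    using carleson_box_negative_moment[of S d] S_box d by auto
  show ?thesis
  proof (rule exI[of _ t], rule exI[of _ s], rule exI[of _ "max C1 C2"], intro conjI allI impI)
    fix a L :: real assume L: "0 < L"
    show "(\<integral>\<^sup>+z\<in>carleson_box a L. ennreal ((L / Im z) powr t) \<partial>W) \<le> ennreal (max C1 C2) * emeasure W (carleson_box a L)"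
      using C1[OF L, of a] by (rule order_trans) (auto intro!: mult_right_mono ennreal_leI)
    show "(\<integral>\<^sup>+z\<in>carleson_box a L. ennreal ((L / Im z) powr s) \<partial>S) \<le> ennreal (max C1 C2) * emeasure S (carleson_box a L)"
      using C2[OF L, of a] by (rule order_trans) (auto intro!: mult_right_mono ennreal_leI)
  qed (use t s in auto)
qed

end

section \<open>Boundedness of the projection\<close>

context half_plane_Ap
begin

text \<open>The factor \<open>(Im z / L) powr (s * (p - 1))\<close> makes the right-hand sides summable over all boxes that
  contain a given point; it is paid for by the negative moment of the dual weight.\<close>

lemma box_mean_bound:
  fixes f :: "complex \<Rightarrow> complex"
  assumes [measurable]: "f \<in> borel_measurable area" and L: "0 < L" and C: "0 < C" and s: "0 < s"
    and moment: "(\<integral>\<^sup>+z\<in>carleson_box a L. ennreal ((L / Im z) powr s) \<partial>S) \<le> ennreal C * emeasure S (carleson_box a L)"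
    and fin: "(\<integral>\<^sup>+z\<in>carleson_box a L. ennreal (norm (f z) powr p * u z * (Im z / L) powr (s * (p - 1))) \<partial>area) < \<infinity>"
  shows "(\<integral>\<^sup>+z\<in>carleson_box a L. ennreal (norm (f z)) \<partial>area) < \<infinity>" (is "?A < _")
    and "ennreal ((enn2real (\<integral>\<^sup>+z\<in>carleson_box a L. ennreal (norm (f z)) \<partial>area) / L\<^sup>2) powr p) * emeasure W (carleson_box a L)
      \<le> ennreal (C powr (p - 1) * K) *
        (\<integral>\<^sup>+z\<in>carleson_box a L. ennreal (norm (f z) powr p * u z * (Im z / L) powr (s * (p - 1))) \<partial>area)" (is "_ \<le> _ * ?F")
proof -
  let ?Q = "carleson_box a L"
  define X Y F where "X = measure W ?Q" and "Y = measure S ?Q" and "F = enn2real ?F"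
  have XYF: "0 \<le> X" "0 \<le> Y" "0 \<le> F" by (auto simp: X_def Y_def F_def)
  have F: "?F = ennreal F" using fin by (simp add: F_def)
  \<comment> \<open>The opposite powers of \<open>Im z / L\<close> in \<open>f1\<close> and
    \<open>g1\<close> cancel in the product. The \<open>p\<close>-th power of \<open>f1\<close> is
    the integrand of the right-hand side, and the conjugate power of \<open>g1\<close> is the
    integrand of the negative moment of \<open>S\<close>.\<close>
  define f1 where "f1 z = norm (f z) * u z powr (1 / p) * (Im z / L) powr (s * (p - 1) / p) * indicator ?Q z" for z
  define g1 where "g1 z = dual z powr ((p - 1) / p) * (L / Im z) powr (s * (p - 1) / p) * indicator ?Q z" for z
  have [measurable]: "f1 \<in> borel_measurable area" "g1 \<in> borel_measurable area"
    unfolding f1_def g1_def by measurable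
  have prod: "f1 z * g1 z = norm (f z) * indicator ?Q z" for z
  proof (cases "z \<in> ?Q")
    case True
    then have "0 < Im z" by (auto simp: carleson_box_def)
    then have "(Im z / L) powr (s * (p - 1) / p) * (L / Im z) powr (s * (p - 1) / p) = 1"
      using L by (simp flip: powr_mult)
    then have "f1 z * g1 z = norm (f z) * (u z powr (1 / p) * dual z powr ((p - 1) / p))"
      using True by (simp add: f1_def g1_def mult_ac)
    then show ?thesis using True by (simp add: u_dual)
  qed (simp add: f1_def)
  have "?A = (\<integral>\<^sup>+z. ennreal (f1 z * g1 z) \<partial>area)"
    by (intro nn_integral_cong) (auto simp: prod indicator_def)
  also have "\<dots> \<le> ennreal (F powr (1 / p) * (C * Y) powr ((p - 1) / p))"
  proof (rule nn_integral_Holder[OF p])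
    have "(f1 z) powr p = norm (f z) powr p * u z * (Im z / L) powr (s * (p - 1)) * indicator ?Q z" for z
      using p pos(2)[of z] L by (cases "z \<in> ?Q") (auto simp: f1_def powr_mult powr_powr carleson_box_def)
    then have "(\<integral>\<^sup>+z. ennreal (f1 z powr p) \<partial>area) = ?F"
      by (intro nn_integral_cong) (auto simp: indicator_def)
    then show "(\<integral>\<^sup>+z. ennreal (f1 z powr p) \<partial>area) \<le> ennreal F" by (simp add: F)
    have "(g1 z) powr (p / (p - 1)) = dual z * (L / Im z) powr s * indicator ?Q z" for z
      using p dual_pos[of z] L by (cases "z \<in> ?Q") (auto simp: g1_def powr_mult powr_powr carleson_box_def)
    then have "(\<integral>\<^sup>+z. ennreal (g1 z powr (p / (p - 1))) \<partial>area)
        = (\<integral>\<^sup>+z\<in>?Q. ennreal (dual z) * ennreal ((L / Im z) powr s) \<partial>area)"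
      using dual_pos by (intro nn_integral_cong) (auto simp: indicator_def ennreal_mult less_imp_le)
    also have "\<dots> = (\<integral>\<^sup>+z\<in>?Q. ennreal ((L / Im z) powr s) \<partial>S)"
      by (rule nn_integral_S[symmetric]) auto
    also have "\<dots> \<le> ennreal (C * Y)"
      using moment C L by (simp add: Y_def emeasure_S_box ennreal_mult)
    finally show "(\<integral>\<^sup>+z. ennreal (g1 z powr (p / (p - 1))) \<partial>area) \<le> ennreal (C * Y)" .
  qed (use XYF C pos(2) dual_pos in \<open>auto simp: f1_def g1_def\<close>)
  finally have le: "?A \<le> ennreal (F powr (1 / p) * (C * Y) powr ((p - 1) / p))" .
  then show fin': "?A < \<infinity>" by (rule le_less_trans) simp
  define A where "A = enn2real ?A"
  have A: "0 \<le> A" "A \<le> F powr (1 / p) * (C * Y) powr ((p - 1) / p)"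
    using le by (auto simp: A_def enn2real_leI)
  have "A powr p \<le> (F powr (1 / p) * (C * Y) powr ((p - 1) / p)) powr p"
    using A p by (intro powr_mono2) auto
  also have "\<dots> = F * (C powr (p - 1) * Y powr (p - 1))"
    using p XYF C by (simp add: powr_mult powr_powr)
  \<comment> \<open>Multiplication by the \<open>W\<close>-mass \<open>X\<close> produces
    \<open>X * Y powr (p - 1)\<close>, which the \<open>A_p\<close> bound replaces by
    \<open>K * (L\<^sup>2) powr p\<close>.\<close>
  finally have "A powr p * X \<le> F * C powr (p - 1) * (X * Y powr (p - 1))"
    using XYF(1) by (auto dest: mult_right_mono[of _ _ X] simp: mult_ac)
  also have "\<dots> \<le> F * C powr (p - 1) * (K * (L\<^sup>2) powr p)"
    using Ap_box[OF L, of a] XYF by (intro mult_left_mono) (auto simp: X_def Y_def)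
  finally have "(A / L\<^sup>2) powr p * X \<le> C powr (p - 1) * K * F"
    using L A by (simp add: powr_divide divide_le_eq mult_ac)
  then show "ennreal ((enn2real ?A / L\<^sup>2) powr p) * emeasure W ?Q \<le> ennreal (C powr (p - 1) * K) * ?F"
    using L XYF K by (simp add: F A_def X_def emeasure_W_box ennreal_leI flip: ennreal_mult)
qed

end

text \<open>Hoelder's inequality for counting measure after inserting opposite powers of
  \<open>L n / y\<close>. With \<open>y\<close> the height of \<open>z\<close>, the hypothesis on
  \<open>B\<close> is the weighted overlap bound, so the plain sum over boxes is controlled by the
  one weighted towards large boxes.\<close>

lemma suminf_Holder_indicator:
  fixes A L :: "nat \<Rightarrow> real" and y :: real and Q :: "nat \<Rightarrow> 'a set"
  assumes p: "1 < p" and nonneg: "\<And>n. 0 \<le> A n" "0 < y" "\<And>n. 0 < L n" "0 \<le> R" "0 \<le> B"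
    and R: "(\<Sum>n. ennreal (A n powr p * (L n / y) powr t) * indicator (Q n) z) \<le> ennreal R"
    and B: "(\<Sum>n. ennreal ((y / L n) powr (t / (p - 1))) * indicator (Q n) z) \<le> ennreal B"
  shows "(\<Sum>n. ennreal (A n) * indicator (Q n) z) \<le> ennreal (R powr (1 / p) * B powr ((p - 1) / p))"
proof -
  define f where "f n = A n * (L n / y) powr (t / p) * indicator (Q n) z" for n
  define g where "g n = (y / L n) powr (t / p) * indicator (Q n) z" for n
  have "(\<Sum>n. ennreal (A n) * indicator (Q n) z) = (\<integral>\<^sup>+n. ennreal (f n * g n) \<partial>count_space UNIV)"
    unfolding nn_integral_count_space_nat
  proof (intro suminf_cong)
    fix n
    have "(L n / y) powr (t / p) * (y / L n) powr (t / p) = 1"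
      using nonneg(2) nonneg(3)[of n] by (simp flip: powr_mult)
    then have "f n * g n = A n * indicator (Q n) z"
      by (cases "z \<in> Q n") (simp_all add: f_def g_def mult.assoc)
    then show "ennreal (A n) * indicator (Q n) z = ennreal (f n * g n)"
      by (simp add: indicator_def)
  qed
  also have "\<dots> \<le> ennreal (R powr (1 / p) * B powr ((p - 1) / p))"
  proof (rule nn_integral_Holder[OF p])
    have "ennreal (f n powr p) = ennreal (A n powr p * (L n / y) powr t) * indicator (Q n) z" for n
      using p nonneg(1)[of n] by (simp add: f_def indicator_def powr_mult powr_powr)
    then show "(\<integral>\<^sup>+n. ennreal (f n powr p) \<partial>count_space UNIV) \<le> ennreal R"
      using R by (simp add: nn_integral_count_space_nat)
    have "ennreal (g n powr (p / (p - 1))) = ennreal ((y / L n) powr (t / (p - 1))) * indicator (Q n) z" for n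
      using p by (simp add: g_def indicator_def powr_powr)
    then show "(\<integral>\<^sup>+n. ennreal (g n powr (p / (p - 1))) \<partial>count_space UNIV) \<le> ennreal B"
      using B by (simp add: nn_integral_count_space_nat)
  qed (use nonneg in \<open>auto simp: f_def g_def\<close>)
  finally show ?thesis .
qed

lemma bergman_kernel_integrand_measurable:
  assumes [measurable]: "f \<in> borel_measurable area"
  shows "bergman_kernel_integrand f z \<in> borel_measurable area"
proof -
  have [measurable]: "(\<lambda>w. (z - cnj w)\<^sup>2) \<in> borel_measurable area"
    by (intro measurable_area_borel borel_measurable_continuous_onI continuous_intros)
  have "(\<lambda>w. - (f w / (z - cnj w)\<^sup>2)) \<in> borel_measurable area" by measurable
  then show ?thesis by (simp add: bergman_kernel_integrand_def[abs_def])
qed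

lemma bergman_proj_bound:
  assumes [measurable]: "f \<in> borel_measurable area"
    and le: "(\<integral>\<^sup>+w\<in>uhp. ennreal (norm (f w) / (norm (z - cnj w))\<^sup>2) \<partial>area) \<le> ennreal B" and B: "0 \<le> B"
  shows "set_integrable area uhp (bergman_kernel_integrand f z)" "norm (bergman_proj f z) \<le> B"
proof -
  let ?h = "\<lambda>w. indicator uhp w *\<^sub>R bergman_kernel_integrand f z w"
  have eq: "(\<integral>\<^sup>+w. ennreal (norm (?h w)) \<partial>area) = (\<integral>\<^sup>+w\<in>uhp. ennreal (norm (f w) / (norm (z - cnj w))\<^sup>2) \<partial>area)"
    by (intro nn_integral_cong)
       (auto simp: indicator_def bergman_kernel_integrand_def norm_divide norm_power)
  have int: "integrable area ?h"
  proof (rule integrableI_bounded)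
    show "?h \<in> borel_measurable area"
      using bergman_kernel_integrand_measurable[OF assms(1)] by measurable
    show "(\<integral>\<^sup>+w. ennreal (norm (?h w)) \<partial>area) < \<infinity>"
      unfolding eq using le by (rule le_less_trans) simp
  qed
  then show "set_integrable area uhp (bergman_kernel_integrand f z)"
    by (simp add: set_integrable_def)
  have "ennreal (norm (bergman_proj f z)) \<le> (\<integral>\<^sup>+w. ennreal (norm (?h w)) \<partial>area)"
    unfolding bergman_proj_def set_lebesgue_integral_def
    by (rule integral_norm_bound_ennreal[OF int])
  also have "\<dots> \<le> ennreal B" using le by (simp only: eq)
  finally show "norm (bergman_proj f z) \<le> B" using B by simp
qed

text \<open>For each \<open>w\<close> a single box of the cover contains both points, and its
  summand already dominates the kernel; summing over all boxes makes the bound independent of that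
  choice and separates \<open>z\<close> from \<open>w\<close>.\<close>

lemma kernel_integral_le_boxes:
  fixes f :: "complex \<Rightarrow> complex"
  assumes [measurable]: "f \<in> borel_measurable area" and z: "z \<in> uhp"
    and L: "\<And>n. 0 < L n"
    and cover: "\<And>z w. z \<in> uhp \<Longrightarrow> w \<in> uhp \<Longrightarrow> \<exists>n. z \<in> carleson_box (a n) (L n) \<and>
      w \<in> carleson_box (a n) (L n) \<and> 1 / (norm (z - cnj w))\<^sup>2 \<le> 25 / (L n)\<^sup>2"
    and fin: "\<And>n. (\<integral>\<^sup>+w\<in>carleson_box (a n) (L n). ennreal (norm (f w)) \<partial>area) < \<infinity>"
  shows "(\<integral>\<^sup>+w\<in>uhp. ennreal (norm (f w) / (norm (z - cnj w))\<^sup>2) \<partial>area)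
    \<le> ennreal 25 * (\<Sum>n. ennreal (enn2real (\<integral>\<^sup>+w\<in>carleson_box (a n) (L n). ennreal (norm (f w)) \<partial>area) / (L n)\<^sup>2)
        * indicator (carleson_box (a n) (L n)) z)"
proof -
  let ?Q = "\<lambda>n. carleson_box (a n) (L n)"
  have pw: "ennreal (norm (f w) / (norm (z - cnj w))\<^sup>2) * indicator uhp w
    \<le> (\<Sum>n. ennreal (25 / (L n)\<^sup>2) * indicator (?Q n) z * (ennreal (norm (f w)) * indicator (?Q n) w))" for w
  proof (cases "w \<in> uhp")
    case True
    obtain n where n: "z \<in> ?Q n" "w \<in> ?Q n" "1 / (norm (z - cnj w))\<^sup>2 \<le> 25 / (L n)\<^sup>2"
      using cover[OF z True] by blast
    have "norm (f w) / (norm (z - cnj w))\<^sup>2 \<le> 25 / (L n)\<^sup>2 * norm (f w)"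
      using mult_right_mono[OF n(3), of "norm (f w)"] by simp
    then have "ennreal (norm (f w) / (norm (z - cnj w))\<^sup>2) * indicator uhp w
      \<le> ennreal (25 / (L n)\<^sup>2) * indicator (?Q n) z * (ennreal (norm (f w)) * indicator (?Q n) w)"
      using n True by (simp add: ennreal_leI flip: ennreal_mult)
    also have "\<dots> \<le> (\<Sum>n. ennreal (25 / (L n)\<^sup>2) * indicator (?Q n) z * (ennreal (norm (f w)) * indicator (?Q n) w))"
      by (rule ennreal_le_suminf)
    finally show ?thesis .
  qed simp
  have "(\<integral>\<^sup>+w\<in>uhp. ennreal (norm (f w) / (norm (z - cnj w))\<^sup>2) \<partial>area)
    \<le> (\<integral>\<^sup>+w. (\<Sum>n. ennreal (25 / (L n)\<^sup>2) * indicator (?Q n) z * (ennreal (norm (f w)) * indicator (?Q n) w)) \<partial>area)"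
    by (intro nn_integral_mono pw)
  also have "\<dots> = (\<Sum>n. ennreal (25 / (L n)\<^sup>2) * indicator (?Q n) z * (\<integral>\<^sup>+w\<in>?Q n. ennreal (norm (f w)) \<partial>area))"
    by (subst nn_integral_suminf) (simp_all add: nn_integral_cmult)
  also have "\<dots> = (\<Sum>n. ennreal 25 * (ennreal (enn2real (\<integral>\<^sup>+w\<in>?Q n. ennreal (norm (f w)) \<partial>area) / (L n)\<^sup>2) * indicator (?Q n) z))"
  proof (intro suminf_cong)
    fix n
    define I where "I = enn2real (\<integral>\<^sup>+w\<in>?Q n. ennreal (norm (f w)) \<partial>area)"
    have I: "0 \<le> I" "(\<integral>\<^sup>+w\<in>?Q n. ennreal (norm (f w)) \<partial>area) = ennreal I"
      using fin[of n] by (auto simp: I_def)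
    show "ennreal (25 / (L n)\<^sup>2) * indicator (?Q n) z * (\<integral>\<^sup>+w\<in>?Q n. ennreal (norm (f w)) \<partial>area)
      = ennreal 25 * (ennreal (enn2real (\<integral>\<^sup>+w\<in>?Q n. ennreal (norm (f w)) \<partial>area) / (L n)\<^sup>2) * indicator (?Q n) z)"
      unfolding I(2) using I(1) by (cases "z \<in> ?Q n") (simp_all del: ennreal_numeral flip: ennreal_mult)
  qed
  also have "\<dots> = ennreal 25 * (\<Sum>n. ennreal (enn2real (\<integral>\<^sup>+w\<in>?Q n. ennreal (norm (f w)) \<partial>area) / (L n)\<^sup>2) * indicator (?Q n) z)"
    by (rule ennreal_suminf_cmult)
  finally show ?thesis .
qed

context half_plane_Ap
begin

text \<open>The kernel integral is at most a sum of box means of \<open>f\<close>. Hoelder's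
  inequality over the boxes bounds its \<open>p\<close>-th power by a multiple of \<open>G\<close>;
  the moment of \<open>W\<close> and the box mean bound turn the \<open>w\<close>-integral of
  \<open>G\<close> into a sum of the \<open>F n\<close>, and the weighted overlap sums these to the
  norm of \<open>f\<close>.\<close>

lemma bergman_proj_bounded:
  "\<exists>C>0. \<forall>f\<in>borel_measurable area. (\<integral>\<^sup>+z\<in>uhp. ennreal (norm (f z) powr p * u z) \<partial>area) < \<infinity> \<longrightarrow>
    (AE z\<in>uhp in area. set_integrable area uhp (bergman_kernel_integrand f z)) \<and>
    (\<integral>\<^sup>+z\<in>uhp. ennreal (norm (bergman_proj f z) powr p * w z) \<partial>area)
      \<le> ennreal C * (\<integral>\<^sup>+z\<in>uhp. ennreal (norm (f z) powr p * u z) \<partial>area)"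
proof -
  obtain t s C where ts: "0 < t" "0 < s" "0 < C"
    and mom: "\<forall>a L. 0 < L \<longrightarrow> (\<integral>\<^sup>+z\<in>carleson_box a L. ennreal ((L / Im z) powr t) \<partial>W) \<le> ennreal C * emeasure W (carleson_box a L)"
      "\<forall>a L. 0 < L \<longrightarrow> (\<integral>\<^sup>+z\<in>carleson_box a L. ennreal ((L / Im z) powr s) \<partial>S) \<le> ennreal C * emeasure S (carleson_box a L)"
    using box_moments by (elim exE conjE) (rule that)
  note momW = mom(1)[rule_format] and momS = mom(2)[rule_format]
  obtain a L :: "nat \<Rightarrow> real" where aL: "\<forall>n. 0 < L n"
      "\<forall>z\<in>uhp. \<forall>w\<in>uhp. \<exists>n. z \<in> carleson_box (a n) (L n) \<and>
        w \<in> carleson_box (a n) (L n) \<and> 1 / (norm (z - cnj w))\<^sup>2 \<le> 25 / (L n)\<^sup>2"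
      "\<forall>\<alpha>>0. \<forall>z\<in>uhp. (\<Sum>n. ennreal ((Im z / L n) powr \<alpha>) * indicator (carleson_box (a n) (L n)) z)
        \<le> ennreal (5 / (1 - 2 powr (- \<alpha>)))"
    using carleson_box_covering by (elim exE conjE) (rule that)
  note L = aL(1)[rule_format] and cover = aL(2)[rule_format] and overlap = aL(3)[rule_format]
  define B where "B \<alpha> = 5 / (1 - (2::real) powr (- \<alpha>))" for \<alpha>
  have B: "0 < B \<alpha>" if "0 < \<alpha>" for \<alpha>
  proof -
    have "(2::real) powr (- \<alpha>) < 2 powr 0" using that by (intro powr_less_mono) auto
    then show ?thesis by (simp add: B_def)
  qed
  \<comment> \<open>\<open>K1\<close> is the constant of the box mean bound, \<open>K2\<close> the
    overlap at exponent \<open>s * (p - 1)\<close>, and \<open>K3\<close> collects the kernel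
    constant \<open>25\<close> and the overlap factor from Hoelder's inequality.\<close>
  define K1 where "K1 = C powr (p - 1) * K"
  define K2 where "K2 = B (s * (p - 1))"
  define K3 where "K3 = 25 powr p * B (t / (p - 1)) powr (p - 1)"
  have B1: "0 < B (t / (p - 1))" using ts p by (intro B) auto
  have K2: "0 < K2" unfolding K2_def using ts p by (intro B) auto
  have K13: "0 < K1" "0 < K3" using K B1 ts by (auto simp: K1_def K3_def)
  let ?Q = "\<lambda>n. carleson_box (a n) (L n)"
  show ?thesis
  proof (intro exI[of _ "K3 * C * K1 * K2"] conjI ballI impI)
    show "0 < K3 * C * K1 * K2" using K13 K2 ts by simp
    fix f :: "complex \<Rightarrow> complex"
    assume f [measurable]: "f \<in> borel_measurable area"
    define \<Phi> where "\<Phi> = (\<integral>\<^sup>+z\<in>uhp. ennreal (norm (f z) powr p * u z) \<partial>area)"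
    assume "(\<integral>\<^sup>+z\<in>uhp. ennreal (norm (f z) powr p * u z) \<partial>area) < \<infinity>"
    then have \<Phi>: "\<Phi> < \<infinity>" by (simp add: \<Phi>_def)
    define F where "F n = (\<integral>\<^sup>+z\<in>?Q n. ennreal (norm (f z) powr p * u z * (Im z / L n) powr (s * (p - 1))) \<partial>area)" for n
    define A where "A n = enn2real (\<integral>\<^sup>+z\<in>?Q n. ennreal (norm (f z)) \<partial>area) / (L n)\<^sup>2" for n
    \<comment> \<open>The factor \<open>(L n / Im z) powr t\<close> is the price of Hoelder's
      inequality over boxes, and it is exactly what the negative moment of \<open>W\<close> can
      absorb.\<close>
    define G where "G z = (\<Sum>n. ennreal (A n powr p * (L n / Im z) powr t) * indicator (?Q n) z)" for z
    have A: "0 \<le> A n" for n by (simp add: A_def)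
    have sumF: "(\<Sum>n. F n) \<le> ennreal K2 * \<Phi>"
    proof -
      have "(\<Sum>n. F n) = (\<integral>\<^sup>+z. (\<Sum>n. ennreal (norm (f z) powr p * u z * (Im z / L n) powr (s * (p - 1))) * indicator (?Q n) z) \<partial>area)"
        unfolding F_def by (rule nn_integral_suminf[symmetric]) measurable
      also have "\<dots> \<le> (\<integral>\<^sup>+z. ennreal K2 * (ennreal (norm (f z) powr p * u z) * indicator uhp z) \<partial>area)"
      proof (intro nn_integral_mono)
        fix z
        have "(\<Sum>n. ennreal (norm (f z) powr p * u z * (Im z / L n) powr (s * (p - 1))) * indicator (?Q n) z)
          = (\<Sum>n. ennreal (norm (f z) powr p * u z) * (ennreal ((Im z / L n) powr (s * (p - 1))) * indicator (?Q n) z))"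
          using pos(2)[of z] by (intro suminf_cong) (simp add: ennreal_mult mult_ac)
        also have "\<dots> = ennreal (norm (f z) powr p * u z) * (\<Sum>n. ennreal ((Im z / L n) powr (s * (p - 1))) * indicator (?Q n) z)"
          by (rule ennreal_suminf_cmult)
        also have "\<dots> \<le> ennreal (norm (f z) powr p * u z) * (ennreal K2 * indicator uhp z)"
        proof (cases "z \<in> uhp")
          case True
          then show ?thesis
            unfolding K2_def B_def using overlap[OF _ True, of "s * (p - 1)"] ts p by (intro mult_left_mono) auto
        next
          case False
          then have "indicator (?Q n) z = (0 :: ennreal)" for n using carleson_box_subset_uhp by (auto simp: indicator_def)
          then show ?thesis by simp
        qed
        finally show "(\<Sum>n. ennreal (norm (f z) powr p * u z * (Im z / L n) powr (s * (p - 1))) * indicator (?Q n) z)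
          \<le> ennreal K2 * (ennreal (norm (f z) powr p * u z) * indicator uhp z)"
          by (simp add: mult_ac)
      qed
      also have "\<dots> = ennreal K2 * \<Phi>" unfolding \<Phi>_def by (rule nn_integral_cmult) measurable
      finally show ?thesis .
    qed
    have F_fin: "F n < \<infinity>" for n
    proof -
      have "F n \<le> (\<Sum>n. F n)" by (rule ennreal_le_suminf)
      also have "\<dots> \<le> ennreal K2 * \<Phi>" by (rule sumF)
      also have "\<dots> < \<infinity>" using \<Phi> by (simp add: ennreal_mult_less_top)
      finally show ?thesis .
    qed
    note mean = box_mean_bound[OF f L ts(3) ts(2) momS[OF L] F_fin[unfolded F_def]]
    have intG: "(\<integral>\<^sup>+z\<in>uhp. ennreal (w z) * G z \<partial>area) \<le> ennreal (C * K1 * K2) * \<Phi>"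
    proof -
      have [measurable]: "G \<in> borel_measurable area" unfolding G_def by measurable
      have "(\<integral>\<^sup>+z\<in>uhp. ennreal (w z) * G z \<partial>area) \<le> (\<integral>\<^sup>+z. ennreal (w z) * G z \<partial>area)"
        by (intro nn_integral_mono) (simp add: indicator_def)
      also have "\<dots> = (\<integral>\<^sup>+z. (\<Sum>n. ennreal (A n powr p) * (ennreal (w z) * ennreal ((L n / Im z) powr t) * indicator (?Q n) z)) \<partial>area)"
        unfolding G_def
        by (intro nn_integral_cong, subst ennreal_suminf_cmult[symmetric], intro suminf_cong)
           (simp add: ennreal_mult mult_ac)
      also have "\<dots> = (\<Sum>n. ennreal (A n powr p) * (\<integral>\<^sup>+z\<in>?Q n. ennreal (w z) * ennreal ((L n / Im z) powr t) \<partial>area))"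
        by (subst nn_integral_suminf) (simp_all add: nn_integral_cmult)
      also have "\<dots> \<le> (\<Sum>n. ennreal (C * K1) * F n)"
      proof (intro suminf_le summableI)
        fix n
        \<comment> \<open>The moment of \<open>W\<close> removes the factor
          \<open>(L n / Im z) powr t\<close> and leaves the mass of the box, to which the box mean
          bound applies.\<close>
        have "ennreal (A n powr p) * (\<integral>\<^sup>+z\<in>?Q n. ennreal (w z) * ennreal ((L n / Im z) powr t) \<partial>area)
          = ennreal (A n powr p) * (\<integral>\<^sup>+z\<in>?Q n. ennreal ((L n / Im z) powr t) \<partial>W)"
          by (subst nn_integral_W) auto
        also have "\<dots> \<le> ennreal (A n powr p) * (ennreal C * emeasure W (?Q n))"
          by (intro mult_left_mono momW L) auto
        also have "\<dots> = ennreal C * (ennreal (A n powr p) * emeasure W (?Q n))"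
          by (simp add: mult_ac)
        also have "\<dots> \<le> ennreal C * (ennreal K1 * F n)"
          unfolding A_def K1_def F_def by (intro mult_left_mono mean(2)) auto
        finally show "ennreal (A n powr p) * (\<integral>\<^sup>+z\<in>?Q n. ennreal (w z) * ennreal ((L n / Im z) powr t) \<partial>area)
          \<le> ennreal (C * K1) * F n"
          using ts K13 by (simp add: ennreal_mult mult_ac)
      qed
      also have "\<dots> = ennreal (C * K1) * (\<Sum>n. F n)" by (rule ennreal_suminf_cmult)
      also have "\<dots> \<le> ennreal (C * K1) * (ennreal K2 * \<Phi>)" by (intro mult_left_mono sumF) simp
      also have "\<dots> = ennreal (C * K1 * K2) * \<Phi>"
        using ts K13 K2 by (simp add: ennreal_mult mult_ac)
      finally show ?thesis .
    qed
    have pointwise: "set_integrable area uhp (bergman_kernel_integrand f z) \<and>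
        ennreal (norm (bergman_proj f z) powr p) \<le> ennreal K3 * G z"
      if z: "z \<in> uhp" and fin: "G z < \<infinity>" for z
    proof -
      define R where "R = enn2real (G z)"
      have R: "0 \<le> R" "G z = ennreal R" using fin by (auto simp: R_def)
      define b where "b = R powr (1 / p) * B (t / (p - 1)) powr ((p - 1) / p)"
      have b: "0 \<le> b" by (simp add: b_def)
      have y: "0 < Im z" using z by (simp add: uhp_def)
      have "(\<integral>\<^sup>+w\<in>uhp. ennreal (norm (f w) / (norm (z - cnj w))\<^sup>2) \<partial>area)
        \<le> ennreal 25 * (\<Sum>n. ennreal (A n) * indicator (?Q n) z)"
        unfolding A_def by (rule kernel_integral_le_boxes[OF f z L cover mean(1)])
      also have "\<dots> \<le> ennreal 25 * ennreal b"
      proof (intro mult_left_mono)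
        show "(\<Sum>n. ennreal (A n) * indicator (?Q n) z) \<le> ennreal b"
          unfolding b_def
        proof (rule suminf_Holder_indicator[OF p A y L R(1) less_imp_le[OF B1]])
          show "(\<Sum>n. ennreal (A n powr p * (L n / Im z) powr t) * indicator (?Q n) z) \<le> ennreal R"
            using R(2) by (simp add: G_def)
          show "(\<Sum>n. ennreal ((Im z / L n) powr (t / (p - 1))) * indicator (?Q n) z) \<le> ennreal (B (t / (p - 1)))"
            unfolding B_def using ts p by (intro overlap z) auto
        qed
      qed simp
      finally have le: "(\<integral>\<^sup>+w\<in>uhp. ennreal (norm (f w) / (norm (z - cnj w))\<^sup>2) \<partial>area) \<le> ennreal (25 * b)"
        using b by (simp add: ennreal_mult)
      note bd = bergman_proj_bound[OF f le]
      have "norm (bergman_proj f z) powr p \<le> (25 * b) powr p"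
        using bd(2) b p by (intro powr_mono2) auto
      also have "\<dots> = K3 * R"
        using R(1) B1 p by (simp add: b_def K3_def powr_mult powr_powr)
      finally show ?thesis
        using bd(1) b R K13 by (simp add: ennreal_leI flip: ennreal_mult)
    qed
    \<comment> \<open>A finite integral forces \<open>w * G\<close> to be finite almost everywhere
      on the half-plane, and \<open>w > 0\<close> passes this on to \<open>G\<close>. Absolute
      convergence of the inner integral follows at such points.\<close>
    have "AE z in area. ennreal (w z) * G z * indicator uhp z \<noteq> \<infinity>"
    proof (rule nn_integral_PInf_AE)
      show "(\<lambda>z. ennreal (w z) * G z * indicator uhp z) \<in> borel_measurable area"
        unfolding G_def by measurable
      have "ennreal (C * K1 * K2) * \<Phi> < \<infinity>" using \<Phi> by (simp add: ennreal_mult_less_top)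
      then show "(\<integral>\<^sup>+z\<in>uhp. ennreal (w z) * G z \<partial>area) \<noteq> \<infinity>"
        using intG by (auto simp: top_unique)
    qed
    moreover have "ennreal (w z) \<noteq> 0" for z
      using pos(1)[of z] by (simp add: ennreal_eq_0_iff not_le)
    ultimately have "AE z\<in>uhp in area. G z < \<infinity>"
      by (auto elim!: eventually_mono simp: less_top ennreal_mult_eq_top_iff)
    then show "AE z\<in>uhp in area. set_integrable area uhp (bergman_kernel_integrand f z)"
      by eventually_elim (use pointwise in auto)
    have "(\<integral>\<^sup>+z\<in>uhp. ennreal (norm (bergman_proj f z) powr p * w z) \<partial>area)
      \<le> (\<integral>\<^sup>+z. ennreal K3 * (ennreal (w z) * G z * indicator uhp z) \<partial>area)"
    proof (intro nn_integral_mono_AE, use \<open>AE z\<in>uhp in area. G z < \<infinity>\<close> in eventually_elim)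
      fix z assume fin: "z \<in> uhp \<longrightarrow> G z < \<infinity>"
      show "ennreal (norm (bergman_proj f z) powr p * w z) * indicator uhp z
        \<le> ennreal K3 * (ennreal (w z) * G z * indicator uhp z)"
      proof (cases "z \<in> uhp")
        case True
        then have "ennreal (norm (bergman_proj f z) powr p) * ennreal (w z) \<le> ennreal K3 * G z * ennreal (w z)"
          using pointwise fin by (intro mult_right_mono) auto
        then show ?thesis using True pos(1)[of z] by (simp add: ennreal_mult mult_ac)
      qed simp
    qed
    also have "\<dots> = ennreal K3 * (\<integral>\<^sup>+z\<in>uhp. ennreal (w z) * G z \<partial>area)"
      unfolding G_def by (rule nn_integral_cmult) measurable
    also have "\<dots> \<le> ennreal K3 * (ennreal (C * K1 * K2) * \<Phi>)"
      by (intro mult_left_mono intG) simp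
    also have "\<dots> = ennreal (K3 * C * K1 * K2) * \<Phi>"
      using ts K13 K2 by (simp add: ennreal_mult mult_ac)
    finally show "(\<integral>\<^sup>+z\<in>uhp. ennreal (norm (bergman_proj f z) powr p * w z) \<partial>area)
      \<le> ennreal (K3 * C * K1 * K2) * (\<integral>\<^sup>+z\<in>uhp. ennreal (norm (f z) powr p * u z) \<partial>area)"
      by (simp add: \<Phi>_def)
  qed
qed

end

section \<open>Necessity of the \<open>A_p\<close> condition\<close>

definition half_disk :: "real \<Rightarrow> real \<Rightarrow> complex set" where
  "half_disk x r = ball (complex_of_real x) r \<inter> uhp"

lemma half_disk_sets [measurable]: "half_disk x r \<in> sets area"
  unfolding half_disk_def by (intro sets.Int borel_in_sets_area uhp_sets_area) simp

lemma half_disk_subset_uhp: "half_disk x r \<subseteq> uhp"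
  by (simp add: half_disk_def)

lemma emeasure_half_disk_le: "0 < r \<Longrightarrow> emeasure area (half_disk x r) \<le> ennreal (r\<^sup>2)"
  using emeasure_mono[of "half_disk x r" "ball (complex_of_real x) r" area] borel_in_sets_area[of "ball (complex_of_real x) r"]
  by (simp add: half_disk_def emeasure_area_ball)

text \<open>This part of the half-disk keeps a distance from the real axis, so locally integrable
  weights are integrable on it, and its area is still comparable to
  \<open>r\<^sup>2\<close>.\<close>

lemma box_top_subset_half_disk:
  assumes "0 < r"
  shows "box_top (x - r / 4) (r / 2) \<subseteq> half_disk x r"
proof
  fix z assume z: "z \<in> box_top (x - r / 4) (r / 2)"
  have "norm (z - complex_of_real x) \<le> \<bar>Re z - x\<bar> + \<bar>Im z\<bar>"
    using cmod_le[of "z - complex_of_real x"] by simp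
  also have "\<dots> < r" using z assms by (auto simp: box_top_def)
  finally show "z \<in> half_disk x r"
    using z assms by (auto simp: half_disk_def dist_norm norm_minus_commute box_top_def uhp_def)
qed

lemma emeasure_half_disk_ge:
  assumes "0 < r"
  shows "ennreal (r\<^sup>2 / (8 * pi)) \<le> emeasure area (half_disk x r)"
proof -
  have "ennreal (r\<^sup>2 / (8 * pi)) \<le> emeasure area (box_top (x - r / 4) (r / 2))"
    using emeasure_box_top_ge[of "r / 2" "x - r / 4"] assms by (simp add: power2_eq_square)
  also have "\<dots> \<le> emeasure area (half_disk x r)"
    by (intro emeasure_mono box_top_subset_half_disk assms) simp
  finally show ?thesis .
qed

text \<open>On neighbouring disks \<open>z - cnj w\<close> is almost real, so the kernel has no cancellation.\<close>

lemma kernel_lower_bound: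
  assumes r: "0 < r" and x: "\<bar>x' - x\<bar> = 6 * r" and w: "w \<in> half_disk x r" and z: "z \<in> half_disk x' r"
  shows "1 / (400 * r\<^sup>2) \<le> Re (1 / (z - cnj w)\<^sup>2)"
proof -
  define a where "a = Re (z - cnj w)"
  define b where "b = Im (z - cnj w)"
  have "norm (w - complex_of_real x) < r" "norm (z - complex_of_real x') < r" "0 < Im w" "0 < Im z"
    using w z by (auto simp: half_disk_def uhp_def dist_norm norm_minus_commute)
  moreover have "\<bar>Re w - x\<bar> \<le> norm (w - complex_of_real x)" "\<bar>Im w\<bar> \<le> norm (w - complex_of_real x)"
    "\<bar>Re z - x'\<bar> \<le> norm (z - complex_of_real x')" "\<bar>Im z\<bar> \<le> norm (z - complex_of_real x')"
    using abs_Re_le_cmod[of "w - complex_of_real x"] abs_Im_le_cmod[of "w - complex_of_real x"]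
      abs_Re_le_cmod[of "z - complex_of_real x'"] abs_Im_le_cmod[of "z - complex_of_real x'"] by auto
  \<comment> \<open>Both real parts are within \<open>r\<close> of centres \<open>6 * r\<close>
    apart, while \<open>b = Im z + Im w\<close>.\<close>
  ultimately have ab: "4 * r \<le> \<bar>a\<bar>" "\<bar>a\<bar> \<le> 8 * r" "0 < b" "b \<le> 2 * r"
    using x by (auto simp: a_def b_def)
  have a2: "(4 * r)\<^sup>2 \<le> a\<^sup>2" "a\<^sup>2 \<le> (8 * r)\<^sup>2"
    using power_mono[OF ab(1), of 2] power_mono[OF ab(2), of 2] r by auto
  have b2: "b\<^sup>2 \<le> (2 * r)\<^sup>2" "0 < b\<^sup>2" using power_mono[OF ab(4), of 2] ab(3) by auto
  have "Re (1 / (z - cnj w)\<^sup>2) = (a\<^sup>2 - b\<^sup>2) / ((a\<^sup>2 - b\<^sup>2)\<^sup>2 + (2 * a * b)\<^sup>2)"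
    by (simp add: Re_divide a_def b_def Re_power2 Im_power2 power_mult_distrib)
  also have "(a\<^sup>2 - b\<^sup>2)\<^sup>2 + (2 * a * b)\<^sup>2 = (a\<^sup>2 + b\<^sup>2)\<^sup>2"
    by (simp add: power2_eq_square algebra_simps)
  finally have eq: "Re (1 / (z - cnj w)\<^sup>2) = (a\<^sup>2 - b\<^sup>2) / (a\<^sup>2 + b\<^sup>2)\<^sup>2" .
  \<comment> \<open>Here \<open>a\<^sup>2 + b\<^sup>2 \<le> 68 * r\<^sup>2\<close> and
    \<open>a\<^sup>2 - b\<^sup>2 \<ge> 12 * r\<^sup>2\<close>; the constant \<open>400\<close> works
    because \<open>68 * 68 = 4624\<close> is below \<open>400 * 12 = 4800\<close>.\<close>
  have "(a\<^sup>2 + b\<^sup>2)\<^sup>2 \<le> (68 * r\<^sup>2)\<^sup>2"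
    using a2 b2 by (intro power_mono) (auto simp: power_mult_distrib)
  also have "\<dots> \<le> 400 * r\<^sup>2 * (12 * r\<^sup>2)" using r by (simp add: power2_eq_square)
  also have "\<dots> \<le> 400 * r\<^sup>2 * (a\<^sup>2 - b\<^sup>2)"
    using a2 b2 by (intro mult_left_mono) (auto simp: power_mult_distrib)
  finally have "(a\<^sup>2 + b\<^sup>2)\<^sup>2 \<le> 400 * r\<^sup>2 * (a\<^sup>2 - b\<^sup>2)" .
  then have "(a\<^sup>2 + b\<^sup>2)\<^sup>2 * 1 \<le> (400 * r\<^sup>2) * (a\<^sup>2 - b\<^sup>2)" by simp
  moreover have "0 < (a\<^sup>2 + b\<^sup>2)\<^sup>2"
    using b2(2) zero_le_power2[of a] by (intro zero_less_power) linarith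
  ultimately show ?thesis using r unfolding eq by (simp add: divide_simps mult_ac)
qed

text \<open>The integrand carries a minus sign, so the negative of its real part is nonnegative and
  at least \<open>g / (400 * r\<^sup>2)\<close> on the half-disk; the modulus dominates that real
  part.\<close>

lemma bergman_proj_lower_bound:
  fixes g :: "complex \<Rightarrow> real"
  assumes r: "0 < r" and x: "\<bar>x' - x\<bar> = 6 * r" and z: "z \<in> half_disk x' r"
    and [measurable]: "g \<in> borel_measurable area" and g: "\<And>z. 0 \<le> g z" and I: "0 \<le> I"
    and gI: "(\<integral>\<^sup>+w\<in>half_disk x r. ennreal (g w) \<partial>area) = ennreal I"
    and int: "set_integrable area uhp (bergman_kernel_integrand (\<lambda>w. complex_of_real (g w * indicator (half_disk x r) w)) z)"
  shows "I / (400 * r\<^sup>2) \<le> norm (bergman_proj (\<lambda>w. complex_of_real (g w * indicator (half_disk x r) w)) z)"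
proof -
  let ?D = "half_disk x r"
  let ?f = "\<lambda>w. complex_of_real (g w * indicator ?D w)"
  let ?h = "\<lambda>w. indicator uhp w *\<^sub>R bergman_kernel_integrand ?f z w"
  have int': "integrable area ?h" using int by (simp add: set_integrable_def)
  have "(\<integral>\<^sup>+w. ennreal (g w * indicator ?D w) \<partial>area) = ennreal I"
    unfolding gI[symmetric] by (intro nn_integral_cong) (simp add: indicator_def)
  then have gint: "integrable area (\<lambda>w. g w * indicator ?D w)" "(LINT w|area. g w * indicator ?D w) = I"
    using nn_integral_eq_integrable[of "\<lambda>w. g w * indicator ?D w" area I] g I by auto
  have "Re (?h w) = - (g w * indicator ?D w * Re (1 / (z - cnj w)\<^sup>2))" for w
  proof (cases "w \<in> ?D")
    case True
    then have "w \<in> uhp" using half_disk_subset_uhp by auto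
    have "?h w = - (complex_of_real (g w) * (1 / (z - cnj w)\<^sup>2))"
      using True \<open>w \<in> uhp\<close> by (simp add: bergman_kernel_integrand_def)
    then show ?thesis using True by (simp only: uminus_complex.sel Re_complex_of_real times_complex.sel Im_complex_of_real) simp
  qed (simp add: bergman_kernel_integrand_def)
  then have pw: "g w * indicator ?D w / (400 * r\<^sup>2) \<le> - Re (?h w)" for w
    using mult_left_mono[OF kernel_lower_bound[OF r x _ z, of w] g[of w]] by (cases "w \<in> ?D") auto
  have "I / (400 * r\<^sup>2) = (LINT w|area. g w * indicator ?D w / (400 * r\<^sup>2))"
    using gint by simp
  also have "\<dots> \<le> (LINT w|area. - Re (?h w))"
    using gint by (intro integral_mono pw Bochner_Integration.integrable_minus integrable_Re[OF int']) auto
  also have "\<dots> = - Re (bergman_proj ?f z)"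
    unfolding bergman_proj_def set_lebesgue_integral_def
    by (simp only: integral_Re[OF int', symmetric] Bochner_Integration.integral_minus)
  also have "\<dots> \<le> norm (bergman_proj ?f z)"
    using abs_Re_le_cmod[of "bergman_proj ?f z"] by linarith
  finally show ?thesis .
qed

context half_plane_weights
begin

text \<open>The setting of necessity: the assumed inequality, and the integrability of
  \<open>u\<close> on top halves that local integrability of the weight supplies.\<close>

context
  fixes C :: real
  assumes C: "0 < C"
    and bounded: "\<And>f. f \<in> borel_measurable area \<Longrightarrow> (\<integral>\<^sup>+z\<in>uhp. ennreal (norm (f z) powr p * u z) \<partial>area) < \<infinity> \<Longrightarrow>
    (AE z\<in>uhp in area. set_integrable area uhp (bergman_kernel_integrand f z)) \<and>
    (\<integral>\<^sup>+z\<in>uhp. ennreal (norm (bergman_proj f z) powr p * w z) \<partial>area)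
      \<le> ennreal C * (\<integral>\<^sup>+z\<in>uhp. ennreal (norm (f z) powr p * u z) \<partial>area)"
    and u_top: "\<And>a L. 0 < L \<Longrightarrow> (\<integral>\<^sup>+z\<in>box_top a L. ennreal (u z) \<partial>area) < \<infinity>"
begin

text \<open>The projection of \<open>g\<close> cut off to one half-disk is bounded below on the
  whole neighbouring half-disk. The neighbour may lie on either side, so the roles of the two can be
  exchanged.\<close>

lemma test_function_bound:
  assumes r: "0 < r" and x: "\<bar>x' - x\<bar> = 6 * r"
    and g_meas [measurable]: "g \<in> borel_measurable area" and g: "\<And>z. 0 \<le> g z" and I: "0 \<le> I"
    and gI: "(\<integral>\<^sup>+w\<in>half_disk x r. ennreal (g w) \<partial>area) = ennreal I"
    and fin: "(\<integral>\<^sup>+w\<in>half_disk x r. ennreal (g w powr p * u w) \<partial>area) < \<infinity>"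
  shows "ennreal ((I / (400 * r\<^sup>2)) powr p) * emeasure W (half_disk x' r)
    \<le> ennreal C * (\<integral>\<^sup>+w\<in>half_disk x r. ennreal (g w powr p * u w) \<partial>area)"
proof -
  let ?D = "half_disk x r"
  let ?f = "\<lambda>w. complex_of_real (g w * indicator ?D w)"
  have [measurable]: "?f \<in> borel_measurable area" by measurable
  have eq: "(\<integral>\<^sup>+z\<in>uhp. ennreal (norm (?f z) powr p * u z) \<partial>area) = (\<integral>\<^sup>+w\<in>?D. ennreal (g w powr p * u w) \<partial>area)"
    using half_disk_subset_uhp[of x r] g by (intro nn_integral_cong) (auto simp: indicator_def)
  have ae: "AE z\<in>uhp in area. set_integrable area uhp (bergman_kernel_integrand ?f z)"
    and le: "(\<integral>\<^sup>+z\<in>uhp. ennreal (norm (bergman_proj ?f z) powr p * w z) \<partial>area)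
      \<le> ennreal C * (\<integral>\<^sup>+w\<in>?D. ennreal (g w powr p * u w) \<partial>area)"
    using bounded[of ?f] fin unfolding eq by auto
  have "ennreal ((I / (400 * r\<^sup>2)) powr p) * emeasure W (half_disk x' r)
    = (\<integral>\<^sup>+z. ennreal ((I / (400 * r\<^sup>2)) powr p) * (ennreal (w z) * indicator (half_disk x' r) z) \<partial>area)"
    by (simp add: emeasure_W nn_integral_cmult)
  also have "\<dots> \<le> (\<integral>\<^sup>+z\<in>uhp. ennreal (norm (bergman_proj ?f z) powr p * w z) \<partial>area)"
  proof (intro nn_integral_mono_AE, use ae in eventually_elim)
    fix z assume int: "z \<in> uhp \<longrightarrow> set_integrable area uhp (bergman_kernel_integrand ?f z)"
    show "ennreal ((I / (400 * r\<^sup>2)) powr p) * (ennreal (w z) * indicator (half_disk x' r) z)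
      \<le> ennreal (norm (bergman_proj ?f z) powr p * w z) * indicator uhp z"
    proof (cases "z \<in> half_disk x' r")
      case True
      then have "z \<in> uhp" using half_disk_subset_uhp by auto
      then have "I / (400 * r\<^sup>2) \<le> norm (bergman_proj ?f z)"
        using bergman_proj_lower_bound[OF r x True g_meas g I gI] int by blast
      then have "(I / (400 * r\<^sup>2)) powr p \<le> norm (bergman_proj ?f z) powr p"
        using I p by (intro powr_mono2) auto
      then show ?thesis
        using True \<open>z \<in> uhp\<close> pos(1)[of z] by (simp add: ennreal_leI flip: ennreal_mult)
    qed simp
  qed
  also note le
  finally show ?thesis .
qed

text \<open>The test function is the indicator of a top half \<open>?T\<close>, since
  \<open>u\<close> might fail to be integrable near the real axis. Its area is at least
  \<open>r\<^sup>2 / (8 * pi)\<close>, and division by \<open>400 * r\<^sup>2\<close> gives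
  \<open>1 / (3200 * pi)\<close>.\<close>

lemma W_half_disk_translate:
  assumes r: "0 < r" and x: "\<bar>x' - x\<bar> = 6 * r"
  shows "ennreal ((1 / (3200 * pi)) powr p) * emeasure W (half_disk x' r) \<le> ennreal (C * c) * emeasure W (half_disk x r)"
proof -
  let ?D = "half_disk x r"
  let ?T = "box_top (x - r / 4) (r / 2)"
  have TD: "?T \<subseteq> ?D" by (rule box_top_subset_half_disk[OF r])
  have "emeasure area ?T \<le> emeasure area ?D" by (intro emeasure_mono TD) simp
  also have "\<dots> \<le> ennreal (r\<^sup>2)" by (rule emeasure_half_disk_le[OF r])
  finally have "emeasure area ?T < \<infinity>" by (rule le_less_trans) simp
  then obtain I where I: "0 \<le> I" "emeasure area ?T = ennreal I"
    by (cases "emeasure area ?T") auto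
  have "ennreal (r\<^sup>2 / (8 * pi)) \<le> emeasure area ?T"
    using emeasure_box_top_ge[of "r / 2" "x - r / 4"] r by (simp add: power2_eq_square)
  then have "r\<^sup>2 / (8 * pi) \<le> I" using I by simp
  then have "1 / (3200 * pi) \<le> I / (400 * r\<^sup>2)" using r by (simp add: field_simps)
  then have Ip: "(1 / (3200 * pi)) powr p \<le> (I / (400 * r\<^sup>2)) powr p"
    using p by (intro powr_mono2) auto
  have uT: "(\<integral>\<^sup>+w\<in>?D. ennreal (indicator ?T w powr p * u w) \<partial>area) = (\<integral>\<^sup>+w\<in>?T. ennreal (u w) \<partial>area)"
    using TD by (intro nn_integral_cong) (auto simp: indicator_def)
  have "ennreal ((1 / (3200 * pi)) powr p) * emeasure W (half_disk x' r)
    \<le> ennreal ((I / (400 * r\<^sup>2)) powr p) * emeasure W (half_disk x' r)"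
    by (intro mult_right_mono ennreal_leI Ip) auto
  also have "\<dots> \<le> ennreal C * (\<integral>\<^sup>+w\<in>?D. ennreal (indicator ?T w powr p * u w) \<partial>area)"
  proof (rule test_function_bound[OF r x _ _ I(1)])
    have "(\<integral>\<^sup>+w\<in>?D. ennreal (indicator ?T w) \<partial>area) = (\<integral>\<^sup>+w. indicator ?T w \<partial>area)"
      using TD by (intro nn_integral_cong) (auto simp: indicator_def)
    then show "(\<integral>\<^sup>+w\<in>?D. ennreal (indicator ?T w) \<partial>area) = ennreal I"
      using I(2) by simp
    show "(\<integral>\<^sup>+w\<in>?D. ennreal (indicator ?T w powr p * u w) \<partial>area) < \<infinity>"
      unfolding uT using r by (intro u_top) simp
  qed auto
  also have "\<dots> \<le> ennreal C * (ennreal c * emeasure W ?T)"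
    unfolding uT using TD half_disk_subset_uhp by (intro mult_left_mono u_le_W) auto
  also have "\<dots> \<le> ennreal C * (ennreal c * emeasure W ?D)"
    by (intro mult_left_mono emeasure_mono TD) auto
  finally show ?thesis using C c by (simp add: ennreal_mult mult_ac)
qed

text \<open>The test function is the dual weight restricted to the set where it is at most
  \<open>n\<close>, which makes all integrals finite. Since \<open>dual powr p * u = dual\<close>,
  its mass and its weighted \<open>p\<close>-integral coincide.\<close>

lemma dual_truncation_bound:
  assumes r: "0 < r" and D: "D = half_disk x r \<inter> {z. dual z \<le> real n}"
  shows "emeasure S D < \<infinity>"
    and "ennreal ((1 / (3200 * pi)) powr p) * (ennreal ((measure S D / (400 * r\<^sup>2)) powr p) * emeasure W (half_disk x r))
      \<le> ennreal (C * c * C) * ennreal (measure S D)"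
proof -
  have Dm [measurable]: "D \<in> sets area"
  proof -
    have "{z \<in> space area. z \<in> half_disk x r \<and> dual z \<le> real n} \<in> sets area" by measurable
    then show ?thesis by (simp add: D Int_def)
  qed
  have "emeasure S D \<le> (\<integral>\<^sup>+z. ennreal (real n) * indicator (half_disk x r) z \<partial>area)"
    unfolding emeasure_S[OF Dm] by (intro nn_integral_mono) (auto simp: D indicator_def intro: ennreal_leI)
  also have "\<dots> = ennreal (real n) * emeasure area (half_disk x r)"
    by (simp add: nn_integral_cmult)
  also have "\<dots> \<le> ennreal (real n) * ennreal (r\<^sup>2)"
    by (intro mult_left_mono emeasure_half_disk_le r) simp
  also have "\<dots> < \<infinity>" by (simp add: ennreal_mult_less_top)
  finally show fin: "emeasure S D < \<infinity>" .
  define I where "I = measure S D"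
  have I: "0 \<le> I" "emeasure S D = ennreal I"
    using fin by (auto simp: I_def emeasure_eq_ennreal_measure)
  \<comment> \<open>The test function lives on the half-disk at \<open>x\<close> and is seen from
    the one at \<open>x'\<close>; translation then replaces the \<open>W\<close>-mass at
    \<open>x'\<close> by that at \<open>x\<close>.\<close>
  define x' where "x' = x + 6 * r"
  have x': "\<bar>x' - x\<bar> = 6 * r" "\<bar>x - x'\<bar> = 6 * r" using r by (auto simp: x'_def)
  define g where "g z = dual z * indicator D z" for z
  have gm [measurable]: "g \<in> borel_measurable area" unfolding g_def by measurable
  have g0: "0 \<le> g z" for z using dual_pos[of z] by (simp add: g_def)
  have g1: "(\<integral>\<^sup>+z\<in>half_disk x r. ennreal (g z) \<partial>area) = ennreal I"
    unfolding I(2)[symmetric] emeasure_S[OF Dm]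
    by (intro nn_integral_cong) (auto simp: g_def D indicator_def)
  have dual_p: "dual z powr p * u z = dual z" for z
  proof -
    have "dual z powr p * u z = u z powr (- 1 / (p - 1) * p) * u z powr 1"
      using pos(2)[of z] by (simp add: dual_def powr_powr)
    also have "\<dots> = u z powr (- 1 / (p - 1) * p + 1)" by (rule powr_add[symmetric])
    also have "- 1 / (p - 1) * p + 1 = - 1 / (p - 1)" using p by (simp add: field_simps)
    finally show ?thesis by (simp add: dual_def)
  qed
  have g2: "(\<integral>\<^sup>+z\<in>half_disk x r. ennreal (g z powr p * u z) \<partial>area) = ennreal I"
    unfolding I(2)[symmetric] emeasure_S[OF Dm]
    by (intro nn_integral_cong) (auto simp: g_def D indicator_def dual_p)
  have "ennreal ((I / (400 * r\<^sup>2)) powr p) * emeasure W (half_disk x' r)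
    \<le> ennreal C * (\<integral>\<^sup>+z\<in>half_disk x r. ennreal (g z powr p * u z) \<partial>area)"
    by (rule test_function_bound[OF r x'(1) gm g0 I(1) g1]) (simp add: g2)
  then have 1: "ennreal ((I / (400 * r\<^sup>2)) powr p) * emeasure W (half_disk x' r) \<le> ennreal C * ennreal I"
    by (simp add: g2)
  have "ennreal ((1 / (3200 * pi)) powr p) * (ennreal ((I / (400 * r\<^sup>2)) powr p) * emeasure W (half_disk x r))
    = ennreal ((I / (400 * r\<^sup>2)) powr p) * (ennreal ((1 / (3200 * pi)) powr p) * emeasure W (half_disk x r))"
    by (simp add: mult_ac)
  also have "\<dots> \<le> ennreal ((I / (400 * r\<^sup>2)) powr p) * (ennreal (C * c) * emeasure W (half_disk x' r))"
    by (intro mult_left_mono W_half_disk_translate[OF r x'(2)]) simp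
  also have "\<dots> = ennreal (C * c) * (ennreal ((I / (400 * r\<^sup>2)) powr p) * emeasure W (half_disk x' r))"
    by (simp add: mult_ac)
  also have "\<dots> \<le> ennreal (C * c) * (ennreal C * ennreal I)"
    by (intro mult_left_mono 1) simp
  also have "\<dots> = ennreal (C * c * C) * ennreal I"
    using C c by (simp add: ennreal_mult mult_ac)
  finally show "ennreal ((1 / (3200 * pi)) powr p) * (ennreal ((measure S D / (400 * r\<^sup>2)) powr p) * emeasure W (half_disk x r))
      \<le> ennreal (C * c * C) * ennreal (measure S D)" by (simp add: I_def)
qed

end

end

section \<open>Half-disks versus boxes\<close>

context half_plane_weights
begin

text \<open>The \<open>A_p\<close> condition with denominators cleared, the area of a half-disk
  being comparable to \<open>r\<^sup>2\<close>. Finiteness is explicit because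
  \<open>measure\<close> is \<open>0\<close> on infinite mass.\<close>

definition disk_condition :: "real \<Rightarrow> bool" where
  "disk_condition k \<longleftrightarrow> (\<forall>x r. 0 < r \<longrightarrow>
    emeasure W (half_disk x r) < \<infinity> \<and> emeasure S (half_disk x r) < \<infinity> \<and>
    measure W (half_disk x r) * measure S (half_disk x r) powr (p - 1) \<le> k * (r\<^sup>2) powr p)"

text \<open>A positive function with vanishing integral would make the half-disk a null set, against
  the lower bound for its area.\<close>

lemma set_nn_integral_half_disk_pos:
  assumes [measurable]: "h \<in> borel_measurable area" and h: "\<And>z. 0 < h z" and r: "0 < r"
  shows "(\<integral>\<^sup>+z\<in>half_disk x r. ennreal (h z) \<partial>area) > 0"
proof -
  have "(\<integral>\<^sup>+z\<in>half_disk x r. ennreal (h z) \<partial>area) \<noteq> 0"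
  proof
    assume "(\<integral>\<^sup>+z\<in>half_disk x r. ennreal (h z) \<partial>area) = 0"
    then have "AE z in area. ennreal (h z) * indicator (half_disk x r) z = 0"
      by (subst (asm) nn_integral_0_iff_AE) auto
    moreover have "ennreal (h z) \<noteq> 0" for z
      using h[of z] by (simp add: ennreal_eq_0_iff not_le)
    ultimately have "AE z in area. z \<notin> half_disk x r"
      by (auto elim!: eventually_mono)
    then have "half_disk x r \<in> null_sets area"
      by (subst AE_iff_null_sets) auto
    then have "emeasure area (half_disk x r) = 0" by auto
    then have "r\<^sup>2 / (8 * pi) \<le> 0"
      using emeasure_half_disk_ge[OF r, of x] by (simp add: ennreal_eq_0_iff)
    moreover have "0 < r\<^sup>2 / (8 * pi)" using r by simp
    ultimately show False by linarith
  qed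
  then show ?thesis by (simp add: zero_less_iff_neq_zero)
qed

lemma W_half_disk_pos: "0 < r \<Longrightarrow> 0 < emeasure W (half_disk x r)"
  by (simp add: emeasure_W set_nn_integral_half_disk_pos pos)

lemma S_half_disk_pos: "0 < r \<Longrightarrow> 0 < emeasure S (half_disk x r)"
  by (simp add: emeasure_S set_nn_integral_half_disk_pos dual_pos)

text \<open>In the truncated estimate one factor \<open>I n\<close> cancels, leaving a bound on
  \<open>X * I n powr (p - 1)\<close> that is uniform in \<open>n\<close>. Monotone convergence
  carries it to the full dual mass and shows that mass to be finite.\<close>

lemma disk_condition_necessary:
  assumes C: "0 < C"
    and bounded: "\<And>f. f \<in> borel_measurable area \<Longrightarrow> (\<integral>\<^sup>+z\<in>uhp. ennreal (norm (f z) powr p * u z) \<partial>area) < \<infinity> \<Longrightarrow>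
    (AE z\<in>uhp in area. set_integrable area uhp (bergman_kernel_integrand f z)) \<and>
    (\<integral>\<^sup>+z\<in>uhp. ennreal (norm (bergman_proj f z) powr p * w z) \<partial>area)
      \<le> ennreal C * (\<integral>\<^sup>+z\<in>uhp. ennreal (norm (f z) powr p * u z) \<partial>area)"
    and u_top: "\<And>a L. 0 < L \<Longrightarrow> (\<integral>\<^sup>+z\<in>box_top a L. ennreal (u z) \<partial>area) < \<infinity>"
  shows "\<exists>k>0. disk_condition k"
proof -
  define \<kappa> where "\<kappa> = (1 / (3200 * pi)) powr p"
  define k where "k = C * c * C * 400 powr p / \<kappa>"
  have \<kappa>: "0 < \<kappa>" by (simp add: \<kappa>_def)
  have k: "0 < k" using C c \<kappa> by (simp add: k_def)
  have "emeasure W (half_disk x r) < \<infinity> \<and> emeasure S (half_disk x r) < \<infinity> \<and>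
    measure W (half_disk x r) * measure S (half_disk x r) powr (p - 1) \<le> k * (r\<^sup>2) powr p" if r: "0 < r" for x r
  proof -
    let ?D = "half_disk x r"
    define E where "E n = ?D \<inter> {z. dual z \<le> real n}" for n :: nat
    define I where "I n = measure S (E n)" for n
    note trunc = dual_truncation_bound[OF C bounded u_top r E_def]
    have I: "0 \<le> I n" "emeasure S (E n) = ennreal (I n)" for n
      using trunc(1)[of n] by (auto simp: I_def emeasure_eq_ennreal_measure)
    have Em [measurable]: "E n \<in> sets S" for n
    proof -
      have "{z \<in> space area. z \<in> half_disk x r \<and> dual z \<le> real n} \<in> sets area" by measurable
      then show ?thesis by (simp add: E_def Int_def)
    qed
    have "(\<Union>n. E n) = ?D"
      by (auto simp: E_def intro: real_arch_simple)
    moreover have "(SUP n. emeasure S (E n)) = emeasure S (\<Union>n. E n)"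
      by (rule SUP_emeasure_incseq) (auto simp: incseq_def E_def)
    ultimately have sup: "emeasure S ?D = (SUP n. ennreal (I n))" by (simp add: I)
    have est: "ennreal \<kappa> * (ennreal ((I n / (400 * r\<^sup>2)) powr p) * emeasure W ?D) \<le> ennreal (C * c * C) * ennreal (I n)" for n
      using trunc(2)[of n] by (simp add: I_def \<kappa>_def)
    \<comment> \<open>One truncation of positive mass already forces the \<open>W\<close>-mass to be
      finite.\<close>
    have "\<exists>n. 0 < I n"
    proof (rule ccontr)
      assume "\<nexists>n. 0 < I n"
      then have "I n = 0" for n using I(1)[of n] by (simp add: not_less order_antisym)
      then show False using S_half_disk_pos[OF r, of x] by (simp add: sup)
    qed
    then obtain n0 where n0: "0 < I n0" by blast
    have "ennreal \<kappa> * (ennreal ((I n0 / (400 * r\<^sup>2)) powr p) * emeasure W ?D) < \<infinity>"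
      using est[of n0] by (rule le_less_trans) (simp add: ennreal_mult_less_top)
    moreover have "0 < (I n0 / (400 * r\<^sup>2)) powr p" using n0 r by simp
    ultimately have Wfin: "emeasure W ?D < \<infinity>"
      using \<kappa> by (auto simp: ennreal_mult_less_top ennreal_eq_0_iff)
    define X where "X = measure W ?D"
    have WX: "emeasure W ?D = ennreal X" using Wfin by (simp add: X_def emeasure_eq_ennreal_measure)
    have X: "0 < X" using W_half_disk_pos[OF r, of x] by (simp add: WX)
    have bnd: "X * I n powr (p - 1) \<le> k * (r\<^sup>2) powr p" for n
    proof (cases "I n = 0")
      case True
      then show ?thesis using k by simp
    next
      case False
      then have In: "0 < I n" using I(1)[of n] by simp
      have "\<kappa> * ((I n / (400 * r\<^sup>2)) powr p * X) \<le> C * c * C * I n"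
        using est[of n] X \<kappa> C c I(1)[of n] by (simp add: WX flip: ennreal_mult)
      also have "(I n / (400 * r\<^sup>2)) powr p = I n * I n powr (p - 1) / (400 powr p * (r\<^sup>2) powr p)"
        using In r by (simp add: powr_divide powr_mult powr_diff)
      finally have "I n * (\<kappa> * X * I n powr (p - 1) / (400 powr p * (r\<^sup>2) powr p)) \<le> I n * (C * c * C)"
        by (simp add: mult_ac)
      then have "\<kappa> * X * I n powr (p - 1) / (400 powr p * (r\<^sup>2) powr p) \<le> C * c * C"
        using In by (simp only: mult_le_cancel_left_pos)
      then show ?thesis using r \<kappa> by (simp add: k_def divide_simps mult_ac)
    qed
    \<comment> \<open>The uniform bound solved for \<open>I n\<close>; it passes to the supremum
      over \<open>n\<close>.\<close>
    define b where "b = (k * (r\<^sup>2) powr p / X) powr (1 / (p - 1))"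
    have "I n \<le> b" for n
    proof -
      have "I n powr (p - 1) \<le> k * (r\<^sup>2) powr p / X" using bnd[of n] X by (simp add: field_simps)
      then have "(I n powr (p - 1)) powr (1 / (p - 1)) \<le> b" unfolding b_def using p by (intro powr_mono2) auto
      then show ?thesis using p I(1)[of n] by (simp add: powr_powr)
    qed
    then have "emeasure S ?D \<le> ennreal b" unfolding sup by (intro SUP_least ennreal_leI)
    then have Sfin: "emeasure S ?D < \<infinity>" and Y: "measure S ?D \<le> b"
      by (auto simp: b_def measure_def intro!: enn2real_leI intro: le_less_trans)
    have "measure S ?D powr (p - 1) \<le> b powr (p - 1)"
      using Y p by (intro powr_mono2) auto
    also have "\<dots> = k * (r\<^sup>2) powr p / X"
      using p X k by (simp add: b_def powr_powr)
    finally have "X * measure S ?D powr (p - 1) \<le> k * (r\<^sup>2) powr p"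
      using X by (simp add: field_simps)
    then show ?thesis using Wfin Sfin by (simp add: X_def)
  qed
  then show ?thesis using k unfolding disk_condition_def by blast
qed

text \<open>A box of side \<open>L\<close> sits in a half-disk of radius \<open>2 * L\<close>, and
  \<open>((2 * L)\<^sup>2) powr p\<close> accounts for the factor \<open>4 powr p\<close>.\<close>

lemma disk_condition_sufficient:
  assumes "disk_condition k" and k: "0 < k"
  shows "half_plane_Ap p c w u (k * 4 powr p)"
proof (unfold_locales)
  show "0 < k * 4 powr p" using k by simp
  fix a L :: real assume L: "0 < L"
  define x where "x = a + L / 2"
  have D: "emeasure W (half_disk x (2 * L)) < \<infinity>" "emeasure S (half_disk x (2 * L)) < \<infinity>"
     "measure W (half_disk x (2 * L)) * measure S (half_disk x (2 * L)) powr (p - 1) \<le> k * ((2 * L)\<^sup>2) powr p"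
    using assms(1)[unfolded disk_condition_def, rule_format, of "2 * L" x] L by auto
  have sub: "carleson_box a L \<subseteq> half_disk x (2 * L)"
    using carleson_box_subset_ball[OF L] by (simp add: half_disk_def x_def)
  have le: "emeasure W (carleson_box a L) \<le> emeasure W (half_disk x (2 * L))"
    "emeasure S (carleson_box a L) \<le> emeasure S (half_disk x (2 * L))"
    using sub by (auto intro!: emeasure_mono)
  show "emeasure W (carleson_box a L) < \<infinity>" "emeasure S (carleson_box a L) < \<infinity>"
    using le D by (auto intro: le_less_trans)
  have "measure W (carleson_box a L) \<le> measure W (half_disk x (2 * L))"
    "measure S (carleson_box a L) \<le> measure S (half_disk x (2 * L))"
    using le D by (auto simp: measure_def intro!: enn2real_mono)
  then have "measure W (carleson_box a L) * measure S (carleson_box a L) powr (p - 1)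
    \<le> measure W (half_disk x (2 * L)) * measure S (half_disk x (2 * L)) powr (p - 1)"
    using p by (intro mult_mono powr_mono2) auto
  also note D(3)
  also have "k * ((2 * L)\<^sup>2) powr p = k * 4 powr p * (L\<^sup>2) powr p"
    by (simp add: power_mult_distrib powr_mult)
  finally show "measure W (carleson_box a L) * measure S (carleson_box a L) powr (p - 1) \<le> k * 4 powr p * (L\<^sup>2) powr p" .
qed

lemma conj_exponent_ratio: "conj_exponent p / p = 1 / (p - 1)" "p / conj_exponent p = p - 1"
  using p by (auto simp: conj_exponent_def)

lemma area_half_disk:
  assumes "0 < r"
  obtains A where "emeasure area (half_disk x r) = ennreal A" "r\<^sup>2 / (8 * pi) \<le> A" "A \<le> r\<^sup>2"
proof -
  have "emeasure area (half_disk x r) < \<infinity>"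
    using emeasure_half_disk_le[OF assms, of x] by (rule le_less_trans) simp
  then obtain A where "0 \<le> A" "emeasure area (half_disk x r) = ennreal A"
    by (cases "emeasure area (half_disk x r)") auto
  then show ?thesis
    using that[of A] emeasure_half_disk_le[OF assms, of x] emeasure_half_disk_ge[OF assms, of x] by auto
qed

text \<open>The area \<open>A\<close> of a half-disk lies between
  \<open>r\<^sup>2 / (8 * pi)\<close> and \<open>r\<^sup>2\<close>: the upper bound serves one
  direction, the lower bound the other, and \<open>A * A powr (p - 1) = A powr p\<close> clears
  denominators.\<close>

lemma Ap_plus_iff_disk_condition: "(w, u) \<in> Ap_plus p \<longleftrightarrow> (\<exists>k>0. disk_condition k)"
proof -
  have dual_eq: "(\<lambda>z. u z powr - (1 / (p - 1))) = dual"
    by (simp add: dual_def fun_eq_iff)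
  have mW: "area_mean (half_disk x r) w = emeasure W (half_disk x r) / emeasure area (half_disk x r)" for x r
    by (simp add: area_mean_def emeasure_W)
  have mS: "area_mean (half_disk x r) dual = emeasure S (half_disk x r) / emeasure area (half_disk x r)" for x r
    by (simp add: area_mean_def emeasure_S)
  have Ap: "(w, u) \<in> Ap_plus p \<longleftrightarrow> (\<exists>k>0. \<forall>x r. 0 < r \<longrightarrow>
    emeasure W (half_disk x r) / emeasure area (half_disk x r) *
      ennpowr (emeasure S (half_disk x r) / emeasure area (half_disk x r)) (p - 1) \<le> ennreal k)"
    by (simp add: Ap_plus_def Let_def dual_eq conj_exponent_ratio mW mS flip: half_disk_def)
  show ?thesis
  proof
    assume "(w, u) \<in> Ap_plus p"
    then obtain k where k: "0 < k" and bnd: "\<And>x r. 0 < r \<Longrightarrow>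
      emeasure W (half_disk x r) / emeasure area (half_disk x r) *
      ennpowr (emeasure S (half_disk x r) / emeasure area (half_disk x r)) (p - 1) \<le> ennreal k"
      unfolding Ap by blast
    have "disk_condition k"
      unfolding disk_condition_def
    proof (intro allI impI)
      fix x r :: real assume r: "0 < r"
      let ?D = "half_disk x r"
      obtain A where A: "emeasure area ?D = ennreal A" "r\<^sup>2 / (8 * pi) \<le> A" "A \<le> r\<^sup>2"
        using area_half_disk[OF r] .
      have "0 < r\<^sup>2 / (8 * pi)" using r by simp
      then have A0: "0 < A" using A(2) by linarith
      note b = bnd[OF r, of x, unfolded A(1)]
      \<comment> \<open>Both means are nonzero, so a finite product forces each factor to be finite
        despite the convention \<open>0 * \<infinity> = 0\<close>.\<close>
      have W0: "emeasure W ?D / ennreal A \<noteq> 0"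
        using W_half_disk_pos[OF r, of x] by (simp add: ennreal_divide_eq_0_iff)
      have S0: "ennpowr (emeasure S ?D / ennreal A) (p - 1) \<noteq> 0"
        using S_half_disk_pos[OF r, of x] A0
        by (auto simp: ennpowr_def ennreal_eq_0_iff not_le enn2real_eq_0_iff ennreal_divide_eq_0_iff)
      have fin: "emeasure W ?D / ennreal A * ennpowr (emeasure S ?D / ennreal A) (p - 1) < \<infinity>"
        using b by (rule le_less_trans) simp
      have fin_div: "v < \<infinity>" if "v / ennreal A < \<infinity>" for v
        using that by (cases v) (auto simp: ennreal_top_divide)
      have mfin: "emeasure W ?D / ennreal A < \<infinity>" "ennpowr (emeasure S ?D / ennreal A) (p - 1) < \<infinity>"
        using fin W0 S0 by (auto simp: ennreal_mult_less_top)
      then have "emeasure S ?D / ennreal A < \<infinity>"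
        by (auto simp: ennpowr_def less_top split: if_splits)
      then have Wfin: "emeasure W ?D < \<infinity>" and Sfin: "emeasure S ?D < \<infinity>"
        using mfin(1) by (blast intro: fin_div)+
      define X Y where "X = measure W ?D" and "Y = measure S ?D"
      have XY: "emeasure W ?D = ennreal X" "emeasure S ?D = ennreal Y" "0 \<le> X" "0 \<le> Y"
        using Wfin Sfin by (auto simp: X_def Y_def emeasure_eq_ennreal_measure less_top)
      have "X / A * (Y / A) powr (p - 1) \<le> k"
        using b XY(3,4) A0 k by (simp add: XY(1,2) divide_ennreal ennpowr_def flip: ennreal_mult)
      then have "X * Y powr (p - 1) \<le> k * (A * A powr (p - 1))"
        using A0 XY by (simp add: powr_divide divide_simps mult_ac)
      also have "A * A powr (p - 1) = A powr p" using A0 by (simp add: powr_diff)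
      also have "k * A powr p \<le> k * (r\<^sup>2) powr p"
        using A A0 k p by (intro mult_left_mono powr_mono2) auto
      finally show "emeasure W ?D < \<infinity> \<and> emeasure S ?D < \<infinity> \<and>
        measure W ?D * measure S ?D powr (p - 1) \<le> k * (r\<^sup>2) powr p"
        using Wfin Sfin by (simp add: X_def Y_def)
    qed
    with k show "\<exists>k>0. disk_condition k" by blast
  next
    assume "\<exists>k>0. disk_condition k"
    then obtain k where k: "0 < k" and dc: "disk_condition k" by blast
    show "(w, u) \<in> Ap_plus p"
      unfolding Ap
    \<comment> \<open>The factor \<open>(8 * pi) powr p\<close> comes from
      \<open>r\<^sup>2 \<le> 8 * pi * A\<close>.\<close>
    proof (intro exI[of _ "k * (8 * pi) powr p"] conjI allI impI)
      show "0 < k * (8 * pi) powr p" using k by simp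
      fix x r :: real assume r: "0 < r"
      let ?D = "half_disk x r"
      obtain A where A: "emeasure area ?D = ennreal A" "r\<^sup>2 / (8 * pi) \<le> A" "A \<le> r\<^sup>2"
        using area_half_disk[OF r] .
      have "0 < r\<^sup>2 / (8 * pi)" using r by simp
      then have A0: "0 < A" using A(2) by linarith
      define X Y where "X = measure W ?D" and "Y = measure S ?D"
      have XY: "emeasure W ?D = ennreal X" "emeasure S ?D = ennreal Y" "0 \<le> X" "0 \<le> Y"
        and bnd: "X * Y powr (p - 1) \<le> k * (r\<^sup>2) powr p"
        using dc[unfolded disk_condition_def, rule_format, OF r, of x]
        by (auto simp: X_def Y_def emeasure_eq_ennreal_measure less_top)
      have "(r\<^sup>2) powr p \<le> (8 * pi * A) powr p"
        using A(2) p r by (intro powr_mono2) (auto simp: field_simps)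
      then have "X * Y powr (p - 1) \<le> k * (8 * pi * A) powr p"
        using bnd k by (meson order_trans mult_left_mono less_imp_le)
      also have "\<dots> = k * (8 * pi) powr p * (A * A powr (p - 1))"
        using A0 by (simp add: powr_mult powr_diff)
      finally have "X / A * (Y / A) powr (p - 1) \<le> k * (8 * pi) powr p"
        using A0 XY by (simp add: powr_divide divide_simps mult_ac)
      then show "emeasure W ?D / emeasure area ?D * ennpowr (emeasure S ?D / emeasure area ?D) (p - 1) \<le> ennreal (k * (8 * pi) powr p)"
        using XY(3,4) A0 k by (simp add: XY(1,2) A(1) divide_ennreal ennpowr_def flip: ennreal_mult)
    qed
  qed
qed

end

section \<open>General weights\<close>

text \<open>The value \<open>1\<close> is assigned outside the half-plane and on the null set where
  the weight is not positive.\<close>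

lemma is_weight_positive_version:
  assumes "is_weight \<mu>"
  shows "\<exists>\<nu>\<in>borel_measurable area. (\<forall>z. 0 < \<nu> z) \<and> (AE z\<in>uhp in area. \<nu> z = \<mu> z)"
proof (intro bexI conjI allI)
  let ?m = "\<lambda>z. indicator uhp z *\<^sub>R \<mu> z"
  let ?\<nu> = "\<lambda>z. if 0 < ?m z then ?m z else (1::real)"
  have [measurable]: "?m \<in> borel_measurable area"
    using assms by (simp add: is_weight_def set_borel_measurable_def)
  show "?\<nu> \<in> borel_measurable area" by measurable
  show "0 < ?\<nu> z" for z by simp
  have "AE z\<in>uhp in area. 0 < \<mu> z" using assms by (simp add: is_weight_def)
  then show "AE z\<in>uhp in area. ?\<nu> z = \<mu> z" by (auto elim!: eventually_mono)
qed

text \<open>The closed rectangle \<open>K\<close> around the top half is compact in the open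
  half-plane, so local integrability applies.\<close>

lemma is_weight_finite_on_box_top:
  assumes \<mu>: "is_weight \<mu>" and L: "0 < L"
  shows "(\<integral>\<^sup>+z\<in>box_top a L. ennreal (\<mu> z) \<partial>area) < \<infinity>"
proof -
  define K where "K = cbox (Complex a (L / 2)) (Complex (a + L) L)"
  have "compact K" "K \<subseteq> uhp"
    using L by (auto simp: K_def uhp_def in_cbox_complex_iff)
  then have int: "integrable area (\<lambda>z. indicator K z *\<^sub>R \<mu> z)"
    using \<mu> by (auto simp: is_weight_def set_integrable_def)
  have "(\<integral>\<^sup>+z\<in>box_top a L. ennreal (\<mu> z) \<partial>area) \<le> (\<integral>\<^sup>+z. ennreal (norm (indicator K z *\<^sub>R \<mu> z)) \<partial>area)"
    by (intro nn_integral_mono)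
       (auto simp: indicator_def K_def box_top_def in_cbox_complex_iff intro!: ennreal_leI)
  also have "\<dots> < \<infinity>" using int by (simp add: integrable_iff_bounded)
  finally show ?thesis .
qed

lemma set_nn_integral_cong_AE_uhp:
  assumes "AE z\<in>uhp in area. f z = g z" and "A \<subseteq> uhp"
  shows "(\<integral>\<^sup>+z\<in>A. f z \<partial>area) = (\<integral>\<^sup>+z\<in>A. g z \<partial>area)"
  using assms by (intro nn_integral_cong_AE) (auto elim!: eventually_mono simp: indicator_def)

lemma Ap_plus_cong_AE:
  assumes "AE z\<in>uhp in area. \<nu>\<^sub>1 z = \<mu>\<^sub>1 z" "AE z\<in>uhp in area. \<nu>\<^sub>2 z = \<mu>\<^sub>2 z"
  shows "(\<nu>\<^sub>1, \<nu>\<^sub>2) \<in> Ap_plus p \<longleftrightarrow> (\<mu>\<^sub>1, \<mu>\<^sub>2) \<in> Ap_plus p"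
proof -
  have "area_mean (ball x r \<inter> uhp) \<nu>\<^sub>1 = area_mean (ball x r \<inter> uhp) \<mu>\<^sub>1" for x r
    unfolding area_mean_def using assms(1)
    by (subst set_nn_integral_cong_AE_uhp[where g = "\<lambda>z. ennreal (\<mu>\<^sub>1 z)"]) auto
  moreover have "area_mean (ball x r \<inter> uhp) (\<lambda>z. \<nu>\<^sub>2 z powr a) = area_mean (ball x r \<inter> uhp) (\<lambda>z. \<mu>\<^sub>2 z powr a)" for x r a
    unfolding area_mean_def using assms(2)
    by (subst set_nn_integral_cong_AE_uhp[where g = "\<lambda>z. ennreal (\<mu>\<^sub>2 z powr a)"]) auto
  ultimately show ?thesis by (simp add: Ap_plus_def)
qed

text \<open>Members of \<open>weighted_Lp\<close> are measurable only on the half-plane; cutting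
  them off there gives globally measurable functions with the same projection.\<close>

lemma bergman_kernel_integrand_restrict:
  "set_integrable area uhp (bergman_kernel_integrand (\<lambda>w. indicator uhp w *\<^sub>R f w) z)
    \<longleftrightarrow> set_integrable area uhp (bergman_kernel_integrand f z)"
  "bergman_proj (\<lambda>w. indicator uhp w *\<^sub>R f w) z = bergman_proj f z"
  unfolding set_integrable_def bergman_proj_def set_lebesgue_integral_def
  by (auto simp: bergman_kernel_integrand_def indicator_def intro!: arg_cong[of _ _ "integrable area"] Bochner_Integration.integral_cong)

theorem proposition1p9:
  fixes p :: real and \<mu>\<^sub>1 \<mu>\<^sub>2 :: "complex \<Rightarrow> real"
  assumes "1 < p"
    and "is_weight \<mu>\<^sub>1" and "is_weight \<mu>\<^sub>2"
    and "\<exists>c>0. AE z\<in>uhp in area. \<mu>\<^sub>2 z \<le> c * \<mu>\<^sub>1 z"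
  shows "(\<exists>C>0. \<forall>f\<in>weighted_Lp p \<mu>\<^sub>2.
            (AE z\<in>uhp in area. set_integrable area uhp (bergman_kernel_integrand f z)) \<and>
            (\<integral>\<^sup>+z\<in>uhp. ennreal (norm (bergman_proj f z) powr p * \<mu>\<^sub>1 z) \<partial>area)
              \<le> ennreal C * (\<integral>\<^sup>+z\<in>uhp. ennreal (norm (f z) powr p * \<mu>\<^sub>2 z) \<partial>area))
         \<longleftrightarrow> (\<mu>\<^sub>1, \<mu>\<^sub>2) \<in> Ap_plus p"
proof -
  \<comment> \<open>Passing to positive representatives changes neither side of the equivalence,
    since all integrals involved are over subsets of the half-plane.\<close>
  obtain w where w: "w \<in> borel_measurable area" "\<forall>z. 0 < w z" "AE z\<in>uhp in area. w z = \<mu>\<^sub>1 z"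
    using is_weight_positive_version[OF assms(2)] by blast
  obtain u where u: "u \<in> borel_measurable area" "\<forall>z. 0 < u z" "AE z\<in>uhp in area. u z = \<mu>\<^sub>2 z"
    using is_weight_positive_version[OF assms(3)] by blast
  obtain c where c: "0 < c" "AE z\<in>uhp in area. \<mu>\<^sub>2 z \<le> c * \<mu>\<^sub>1 z"
    using assms(4) by blast
  have "AE z\<in>uhp in area. u z \<le> c * w z"
    using c(2) w(3) u(3) by eventually_elim simp
  then interpret half_plane_weights p c w u
    using assms(1) c(1) w u by unfold_locales auto
  have int_w: "(\<integral>\<^sup>+z\<in>uhp. ennreal (h z * \<mu>\<^sub>1 z) \<partial>area) = (\<integral>\<^sup>+z\<in>uhp. ennreal (h z * w z) \<partial>area)" for h
    using w(3) by (intro set_nn_integral_cong_AE_uhp) (auto elim!: eventually_mono)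
  have int_u: "(\<integral>\<^sup>+z\<in>A. ennreal (h z * \<mu>\<^sub>2 z) \<partial>area) = (\<integral>\<^sup>+z\<in>A. ennreal (h z * u z) \<partial>area)" if "A \<subseteq> uhp" for h A
    using u(3) that by (intro set_nn_integral_cong_AE_uhp) (auto elim!: eventually_mono)
  have Ap: "(\<mu>\<^sub>1, \<mu>\<^sub>2) \<in> Ap_plus p \<longleftrightarrow> (\<exists>k>0. disk_condition k)"
    using Ap_plus_cong_AE[OF w(3) u(3)] Ap_plus_iff_disk_condition by simp
  show ?thesis
    unfolding Ap int_w int_u[OF subset_refl]
  proof
    assume "\<exists>C>0. \<forall>f\<in>weighted_Lp p \<mu>\<^sub>2.
            (AE z\<in>uhp in area. set_integrable area uhp (bergman_kernel_integrand f z)) \<and>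
            (\<integral>\<^sup>+z\<in>uhp. ennreal (norm (bergman_proj f z) powr p * w z) \<partial>area)
              \<le> ennreal C * (\<integral>\<^sup>+z\<in>uhp. ennreal (norm (f z) powr p * u z) \<partial>area)"
    then obtain C where C: "0 < C" and bounded: "\<And>f. f \<in> weighted_Lp p \<mu>\<^sub>2 \<Longrightarrow>
            (AE z\<in>uhp in area. set_integrable area uhp (bergman_kernel_integrand f z)) \<and>
            (\<integral>\<^sup>+z\<in>uhp. ennreal (norm (bergman_proj f z) powr p * w z) \<partial>area)
              \<le> ennreal C * (\<integral>\<^sup>+z\<in>uhp. ennreal (norm (f z) powr p * u z) \<partial>area)"
      by blast
    show "\<exists>k>0. disk_condition k"
    proof (rule disk_condition_necessary[OF C bounded])
      fix f :: "complex \<Rightarrow> complex"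
      assume "f \<in> borel_measurable area" and "(\<integral>\<^sup>+z\<in>uhp. ennreal (norm (f z) powr p * u z) \<partial>area) < \<infinity>"
      then show "f \<in> weighted_Lp p \<mu>\<^sub>2"
        by (simp add: weighted_Lp_def set_borel_measurable_def int_u)
    next
      fix a L :: real assume L: "0 < L"
      then have "box_top a L \<subseteq> uhp" using box_top_subset carleson_box_subset_uhp by blast
      then show "(\<integral>\<^sup>+z\<in>box_top a L. ennreal (u z) \<partial>area) < \<infinity>"
        using is_weight_finite_on_box_top[OF assms(3) L, of a] int_u[of _ "\<lambda>_. 1"] by simp
    qed
  next
    assume "\<exists>k>0. disk_condition k"
    then obtain k where "0 < k" "disk_condition k" by blast
    then interpret half_plane_Ap p c w u "k * 4 powr p"
      by (intro disk_condition_sufficient)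
    obtain C where C: "0 < C" and bounded: "\<forall>f\<in>borel_measurable area.
      (\<integral>\<^sup>+z\<in>uhp. ennreal (norm (f z) powr p * u z) \<partial>area) < \<infinity> \<longrightarrow>
      (AE z\<in>uhp in area. set_integrable area uhp (bergman_kernel_integrand f z)) \<and>
      (\<integral>\<^sup>+z\<in>uhp. ennreal (norm (bergman_proj f z) powr p * w z) \<partial>area)
        \<le> ennreal C * (\<integral>\<^sup>+z\<in>uhp. ennreal (norm (f z) powr p * u z) \<partial>area)"
      using bergman_proj_bounded by blast
    show "\<exists>C>0. \<forall>f\<in>weighted_Lp p \<mu>\<^sub>2.
            (AE z\<in>uhp in area. set_integrable area uhp (bergman_kernel_integrand f z)) \<and>
            (\<integral>\<^sup>+z\<in>uhp. ennreal (norm (bergman_proj f z) powr p * w z) \<partial>area)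
              \<le> ennreal C * (\<integral>\<^sup>+z\<in>uhp. ennreal (norm (f z) powr p * u z) \<partial>area)"
    proof (intro exI[of _ C] conjI[OF C] ballI)
      fix f assume f: "f \<in> weighted_Lp p \<mu>\<^sub>2"
      let ?f = "\<lambda>w. indicator uhp w *\<^sub>R f w"
      have fm: "?f \<in> borel_measurable area"
        and fin: "(\<integral>\<^sup>+z\<in>uhp. ennreal (norm (f z) powr p * u z) \<partial>area) < \<infinity>"
        using f by (auto simp: weighted_Lp_def set_borel_measurable_def int_u)
      have eq: "(\<integral>\<^sup>+z\<in>uhp. ennreal (norm (?f z) powr p * u z) \<partial>area) = (\<integral>\<^sup>+z\<in>uhp. ennreal (norm (f z) powr p * u z) \<partial>area)"
        by (intro nn_integral_cong) (simp add: indicator_def)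
      show "(AE z\<in>uhp in area. set_integrable area uhp (bergman_kernel_integrand f z)) \<and>
            (\<integral>\<^sup>+z\<in>uhp. ennreal (norm (bergman_proj f z) powr p * w z) \<partial>area)
              \<le> ennreal C * (\<integral>\<^sup>+z\<in>uhp. ennreal (norm (f z) powr p * u z) \<partial>area)"
        using bounded[rule_format, OF fm] fin unfolding eq bergman_kernel_integrand_restrict by blast
    qed
  qed
qed

end
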